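(* Let $X\subset\mathbb{R}^2$ be the metric measure space described in the context (a doubling, in fact Ahlfors $1$-regular, metric measure space), let $(\varepsilon_j)_{j\in\mathbb{N}}$ be a sequence of numbers $\varepsilon_j\in(0,1]$ with $\varepsilon_j\to0$, let $0<\alpha<1$, and let $h(t)=t^{-\alpha}\log^{-1}(e/t)$ for $t\in(0,1)$. Then for $p\in(1,\infty)$ the weight $f=f_h$ on $X$ satisfies $f\in RH_p$ if and only if $p\le 1/\alpha$. In particular, the strong self-improving property "$RH_q\Rightarrow RH_{q+\varepsilon}$ for some $\varepsilon>0$" fails in general spaces of homogeneous type (even metric ones).
   Context: The space: equip $\mathbb{R}^2$ with the $\ell^\infty$ metric. Let $A=\{(u,0):u\in\mathbb{R}\}$, $U=\{(u,\tfrac12u):u\in(0,1]\}$, $V=\{(1,v):v\in[\tfrac12,1]\}$, $W=U\cup V$, and for $j\in\mathbb{N}$ let $U_j=U+(10j,0)$, $V_j=V+(10j,0)$, $W_j=W+(10j,0)=U_j\cup V_j$. Set $X=A\cup\bigcup_{j\in\mathbb{N}}W_j$ with the $\ell^\infty$ metric and the arc-length measure $\mu$. The weight: for a positive function $h$ on $(0,1)$ let $g(t)=\max\{h(t),1\}$ and define $f=f_h:X\to(0,\infty)$ by $f(x)=1$ if $x\in A$; $f(x)=\varepsilon_j$ if $x\in V_j$; $f(x)=\min\{1,\varepsilon_j g(u)\}$ if $x=(10j+u,\tfrac12u)\in U_j$ (points common to $U_j$ and $V_j$ have measure zero and are irrelevant). Weight class: for $q\in(1,\infty)$, a weight (nonnegative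 measurable function) $w$ belongs to $RH_q$ if there is a finite constant $C$ with $\left(\frac{1}{\mu(B)}\int_Bw^q\,d\mu\right)^{1/q}\le C\frac{1}{\mu(B)}\int_Bw\,d\mu$ for every ball $B$ of $X$. *)

theory Defs
  imports "HOL-Analysis.Analysis"
begin

section \<open>Spaces of homogeneous type and reverse Hoelder weights\<close>

definition quasi_metric_on :: "'a set \<Rightarrow> ('a \<Rightarrow> 'a \<Rightarrow> real) \<Rightarrow> bool" where
  "quasi_metric_on M d \<longleftrightarrow>
     (\<forall>x\<in>M. \<forall>y\<in>M. 0 \<le> d x y \<and> d x y = d y x \<and> (d x y = 0 \<longleftrightarrow> x = y)) \<and>
     (\<exists>K::real. \<forall>x\<in>M. \<forall>y\<in>M. \<forall>z\<in>M. d x z \<le> K * (d x y + d y z))"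

text \<open>The locale constant \<open>Metric_space.mball\<close> is only usable for a genuine metric; the following
  ball also makes sense for a quasi-metric, and agrees with it in the metric case.\<close>

definition qball :: "'a set \<Rightarrow> ('a \<Rightarrow> 'a \<Rightarrow> real) \<Rightarrow> 'a \<Rightarrow> real \<Rightarrow> 'a set" where
  "qball M d x r = {y\<in>M. d x y < r}"

lemma qball_eq_mball:
  assumes "Metric_space M d" "x \<in> M"
  shows "qball M d x r = Metric_space.mball M d x r"
  using assms by (auto simp: qball_def Metric_space.in_mball)

text \<open>Quasi-metric balls need not be open, hence the separate measurability requirement on them.\<close>

definition homogeneous_type :: "'a set \<Rightarrow> ('a \<Rightarrow> 'a \<Rightarrow> real) \<Rightarrow> 'a measure \<Rightarrow> bool" where
  "homogeneous_type M d \<mu> \<longleftrightarrow>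
     quasi_metric_on M d \<and> space \<mu> = M \<and>
     (\<forall>G\<subseteq>M. (\<forall>x\<in>G. \<exists>r>0. qball M d x r \<subseteq> G) \<longrightarrow> G \<in> sets \<mu>) \<and>
     (\<forall>x\<in>M. \<forall>r>0. qball M d x r \<in> sets \<mu> \<and>
        0 < emeasure \<mu> (qball M d x r) \<and> emeasure \<mu> (qball M d x r) < \<infinity>) \<and>
     (\<exists>C::real. \<forall>x\<in>M. \<forall>r>0.
        emeasure \<mu> (qball M d x (2 * r)) \<le> ennreal C * emeasure \<mu> (qball M d x r))"

text \<open>Radii range up to the diameter of \<open>M\<close>, which may be infinite.\<close>

definition Ahlfors_regular :: "real \<Rightarrow> 'a set \<Rightarrow> ('a \<Rightarrow> 'a \<Rightarrow> real) \<Rightarrow> 'a measure \<Rightarrow> bool" where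
  "Ahlfors_regular s M d \<mu> \<longleftrightarrow>
     (\<exists>C>0. \<forall>x\<in>M. \<forall>r>0. (\<exists>y\<in>M. \<exists>z\<in>M. r < d y z) \<longrightarrow>
        ennreal (r powr s / C) \<le> emeasure \<mu> (qball M d x r) \<and>
        emeasure \<mu> (qball M d x r) \<le> ennreal (C * r powr s))"

text \<open>Powers of extended nonnegative reals, for exponents \<open>a > 0\<close> only.\<close>

definition ennreal_powr :: "ennreal \<Rightarrow> real \<Rightarrow> ennreal" where
  "ennreal_powr x a = (if x = \<infinity> then \<infinity> else ennreal (enn2real x powr a))"

definition average :: "'a measure \<Rightarrow> 'a set \<Rightarrow> ('a \<Rightarrow> real) \<Rightarrow> ennreal" where
  "average \<mu> B w = (\<integral>\<^sup>+x\<in>B. ennreal (w x) \<partial>\<mu>) / emeasure \<mu> B"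

definition RH :: "'a set \<Rightarrow> ('a \<Rightarrow> 'a \<Rightarrow> real) \<Rightarrow> 'a measure \<Rightarrow> real \<Rightarrow> ('a \<Rightarrow> real) set" where
  "RH M d \<mu> q = {w. w \<in> borel_measurable \<mu> \<and> (\<forall>x\<in>M. 0 \<le> w x) \<and>
     (\<exists>C::real. \<forall>x\<in>M. \<forall>r>0.
        ennreal_powr (average \<mu> (qball M d x r) (\<lambda>y. w y powr q)) (1 / q)
          \<le> ennreal C * average \<mu> (qball M d x r) w)}"

definition strong_self_improving :: "'a set \<Rightarrow> ('a \<Rightarrow> 'a \<Rightarrow> real) \<Rightarrow> 'a measure \<Rightarrow> bool" where
  "strong_self_improving M d \<mu> \<longleftrightarrow>
     (\<forall>q>1. \<forall>w. w \<in> RH M d \<mu> q \<longrightarrow> (\<exists>\<epsilon>>0. w \<in> RH M d \<mu> (q + \<epsilon>)))"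

section \<open>The space\<close>

definition linf :: "real \<times> real \<Rightarrow> real \<times> real \<Rightarrow> real" where
  "linf x y = infnorm (x - y)"

lemma linf_eq: "linf x y = max \<bar>fst x - fst y\<bar> \<bar>snd x - snd y\<bar>"
  by (cases x; cases y)
     (simp add: linf_def infnorm_Max Basis_prod_def image_Un image_image max.commute)

definition set_A :: "(real \<times> real) set" where
  "set_A = {(u, 0) | u. True}"

definition set_U :: "nat \<Rightarrow> (real \<times> real) set" where
  "set_U j = (\<lambda>x. x + (10 * real j, 0)) ` {(u, u / 2) | u. u \<in> {0<..1}}"

definition set_V :: "nat \<Rightarrow> (real \<times> real) set" where
  "set_V j = (\<lambda>x. x + (10 * real j, 0)) ` {(1, v) | v. v \<in> {1/2..1}}"

definition set_W :: "nat \<Rightarrow> (real \<times> real) set" where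
  "set_W j = set_U j \<union> set_V j"

definition set_X :: "(real \<times> real) set" where
  "set_X = set_A \<union> (\<Union>j. set_W j)"

text \<open>Arc length along an injective differentiable curve \<open>\<gamma>\<close> restricted to the parameter set \<open>I\<close>.
  Length is taken with respect to the metric \<^const>\<open>linf\<close> of the space, so the speed is measured
  in the maximum norm.\<close>

definition curve_length :: "(real \<Rightarrow> real \<times> real) \<Rightarrow> real set \<Rightarrow> (real \<times> real) measure" where
  "curve_length \<gamma> I =
     distr (density lborel (\<lambda>t. ennreal (infnorm (vector_derivative \<gamma> (at t))) * indicator I t))
       borel \<gamma>"

text \<open>The pieces overlap in at most one point each, so that the arc length of \<open>E\<close> is the sum of
  the lengths of its parts.\<close>

definition arc_length :: "(real \<times> real) set \<Rightarrow> ennreal" where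
  "arc_length E =
     emeasure (curve_length (\<lambda>u. (u, 0)) UNIV) E +
     (\<Sum>j. emeasure (curve_length (\<lambda>u. (10 * real j + u, u / 2)) {0<..1}) E +
          emeasure (curve_length (\<lambda>v. (10 * real j + 1, v)) {1/2..1}) E)"

definition mu :: "(real \<times> real) measure" where
  "mu = measure_of set_X (sets (restrict_space borel set_X)) arc_length"

lemma space_mu [simp]: "space mu = set_X"
  and sets_mu: "sets mu = sets (restrict_space borel set_X)"
proof -
  have s: "space (restrict_space borel set_X) = set_X"
    by (simp add: space_restrict_space)
  have "sets (restrict_space borel set_X) \<subseteq> Pow set_X"
    using sets.space_closed[of "restrict_space borel set_X"] s by simp
  then show "space mu = set_X"
    by (simp add: mu_def space_measure_of)
  show "sets mu = sets (restrict_space borel set_X)"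
    using sets.sets_measure_of_eq[of "restrict_space borel set_X"] s by (simp add: mu_def)
qed

lemma mem_set_A: "x \<in> set_A \<longleftrightarrow> snd x = 0"
  by (cases x) (auto simp: set_A_def)

lemma mem_set_U:
  "x \<in> set_U j \<longleftrightarrow> 0 < fst x - 10 * real j \<and> fst x - 10 * real j \<le> 1 \<and>
     snd x = (fst x - 10 * real j) / 2"
proof
  assume "x \<in> set_U j"
  then show "0 < fst x - 10 * real j \<and> fst x - 10 * real j \<le> 1 \<and> snd x = (fst x - 10 * real j) / 2"
    by (auto simp: set_U_def)
next
  assume *: "0 < fst x - 10 * real j \<and> fst x - 10 * real j \<le> 1 \<and> snd x = (fst x - 10 * real j) / 2"
  define u where "u = fst x - 10 * real j"
  have "x = (u, u / 2) + (10 * real j, 0)" "u \<in> {0<..1}"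
    using * by (auto simp: u_def prod_eq_iff)
  then show "x \<in> set_U j"
    unfolding set_U_def by blast
qed

lemma mem_set_V:
  "x \<in> set_V j \<longleftrightarrow> fst x = 10 * real j + 1 \<and> 1/2 \<le> snd x \<and> snd x \<le> 1"
proof
  assume "x \<in> set_V j"
  then show "fst x = 10 * real j + 1 \<and> 1/2 \<le> snd x \<and> snd x \<le> 1"
    by (auto simp: set_V_def)
next
  assume *: "fst x = 10 * real j + 1 \<and> 1/2 \<le> snd x \<and> snd x \<le> 1"
  then have "x = (1, snd x) + (10 * real j, 0)" "snd x \<in> {1/2..1}"
    by (auto simp: prod_eq_iff)
  then show "x \<in> set_V j"
    unfolding set_V_def by blast
qed

lemma set_X_borel: "set_X \<in> sets borel"
proof -
  have [measurable]: "fst \<in> borel_measurable (borel :: (real \<times> real) measure)"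
    "snd \<in> borel_measurable (borel :: (real \<times> real) measure)"
    by (intro borel_measurable_continuous_onI continuous_intros)+
  have "set_X = {x \<in> space borel. snd x = 0 \<or> (\<exists>j. (0 < fst x - 10 * real j \<and>
      fst x - 10 * real j \<le> 1 \<and> snd x = (fst x - 10 * real j) / 2) \<or>
      (fst x = 10 * real j + 1 \<and> 1/2 \<le> snd x \<and> snd x \<le> 1))}"
    by (auto simp: set_X_def set_W_def mem_set_A mem_set_U mem_set_V)
  also have "\<dots> \<in> sets borel"
    by measurable
  finally show ?thesis .
qed

lemma sets_mu_iff: "E \<in> sets mu \<longleftrightarrow> E \<subseteq> set_X \<and> E \<in> sets borel"
  using set_X_borel by (simp add: sets_mu sets_restrict_space_iff)

lemma emeasure_curve_length:
  assumes \<gamma>: "\<And>t. (\<gamma> has_vector_derivative v) (at t)" and v: "infnorm v = 1"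
    and I: "I \<in> sets borel" and E: "E \<in> sets borel"
  shows "emeasure (curve_length \<gamma> I) E = emeasure lborel {t\<in>I. \<gamma> t \<in> E}"
proof -
  have "continuous_on UNIV \<gamma>"
    by (meson \<gamma> continuous_at_imp_continuous_on has_vector_derivative_continuous)
  then have [measurable]: "\<gamma> \<in> borel_measurable borel"
    by (rule borel_measurable_continuous_onI)
  have vd: "vector_derivative \<gamma> (at t) = v" for t
    by (rule vector_derivative_at[OF \<gamma>])
  have "\<gamma> -` E \<in> sets borel"
    using measurable_sets[of \<gamma> borel borel E] E by simp
  moreover have "I \<inter> \<gamma> -` E = {t\<in>I. \<gamma> t \<in> E}"
    by auto
  ultimately show ?thesis
    using I E by (simp add: curve_length_def vd v emeasure_distr emeasure_density
        nn_integral_set_ennreal flip: indicator_inter_arith)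
qed

text \<open>\<^const>\<open>arc_length\<close> is indeed countably additive, and explicitly given as follows.\<close>

lemma emeasure_mu:
  assumes "E \<in> sets mu"
  shows "emeasure mu E = arc_length E"
proof (rule emeasure_measure_of[OF mu_def])
  show "sets (restrict_space borel set_X) \<subseteq> Pow set_X"
    using sets.space_closed[of mu] by (simp add: sets_mu)
  show "positive (sets mu) arc_length"
    by (simp add: positive_def arc_length_def)
  show "countably_additive (sets mu) arc_length"
  proof (rule countably_additiveI)
    fix F :: "nat \<Rightarrow> (real \<times> real) set"
    assume F: "range F \<subseteq> sets mu" "disjoint_family F"
    have FN: "range F \<subseteq> sets N" if "sets N = sets borel" for N
      using F(1) that by (auto simp: sets_mu_iff image_subset_iff)
    have eq: "(\<Sum>i. emeasure (curve_length \<gamma> I) (F i)) = emeasure (curve_length \<gamma> I) (\<Union>i. F i)"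
      for \<gamma> I
      by (rule suminf_emeasure[OF FN F(2)]) (simp add: curve_length_def)
    have swap: "(\<Sum>i. \<Sum>j. g i j) = (\<Sum>j. \<Sum>i. g i j)" for g :: "nat \<Rightarrow> nat \<Rightarrow> ennreal"
      using nn_integral_suminf[of "\<lambda>j i. g i j" "count_space UNIV"]
      by (simp add: nn_integral_count_space_nat)
    show "(\<Sum>i. arc_length (F i)) = arc_length (\<Union>i. F i)"
      unfolding arc_length_def
      by (subst suminf_add[symmetric]; (simp add: eq)?; subst swap)
         (simp add: eq suminf_add[symmetric])
  qed
qed (rule assms)

lemma emeasure_mu_explicit:
  assumes "E \<in> sets mu"
  shows "emeasure mu E = emeasure lborel {u. (u, 0) \<in> E} +
    (\<Sum>j. emeasure lborel {u\<in>{0<..1}. (10 * real j + u, u / 2) \<in> E} +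
         emeasure lborel {v\<in>{1/2..1}. (10 * real j + 1, v) \<in> E})"
proof -
  have E: "E \<in> sets borel"
    using assms by (simp add: sets_mu_iff)
  have inf: "infnorm (a, b) = max \<bar>a\<bar> \<bar>b\<bar>" for a b :: real
    using linf_eq[of "(a, b)" 0] by (simp add: linf_def)
  have 1: "emeasure (curve_length (\<lambda>u. (u, 0)) UNIV) E = emeasure lborel {u\<in>UNIV. (u, 0) \<in> E}"
    by (rule emeasure_curve_length[where v = "(1, 0)"])
       (auto intro!: derivative_eq_intros has_vector_derivative_Pair simp: inf E)
  have 2: "emeasure (curve_length (\<lambda>u. (10 * real j + u, u / 2)) {0<..1}) E =
      emeasure lborel {u\<in>{0<..1}. (10 * real j + u, u / 2) \<in> E}" for j
    by (rule emeasure_curve_length[where v = "(1, 1/2)"])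
       (auto intro!: derivative_eq_intros has_vector_derivative_Pair simp: inf E)
  have 3: "emeasure (curve_length (\<lambda>v. (10 * real j + 1, v)) {1/2..1}) E =
      emeasure lborel {v\<in>{1/2..1}. (10 * real j + 1, v) \<in> E}" for j
    by (rule emeasure_curve_length[where v = "(0, 1)"])
       (auto intro!: derivative_eq_intros has_vector_derivative_Pair simp: inf E)
  show ?thesis
    using assms by (simp only: emeasure_mu arc_length_def 1 2 3) simp
qed

section \<open>The weight\<close>

text \<open>The sets \<^term>\<open>set_W j\<close> are pairwise disjoint and disjoint from \<^const>\<open>set_A\<close>, so the index
  below is uniquely determined. A common point of \<^term>\<open>set_U j\<close> and \<^term>\<open>set_V j\<close> gets the value
  for \<^term>\<open>set_V j\<close>, so that \<open>h\<close> is only evaluated on the open unit interval.\<close>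

definition weight :: "(nat \<Rightarrow> real) \<Rightarrow> (real \<Rightarrow> real) \<Rightarrow> real \<times> real \<Rightarrow> real" where
  "weight \<epsilon> h x =
     (if x \<in> set_A then 1
      else let j = (THE j. x \<in> set_W j); g = (\<lambda>t. max (h t) 1) in
        if x \<in> set_V j then \<epsilon> j else min 1 (\<epsilon> j * g (fst x - 10 * real j)))"

lemma weight_A: "x \<in> set_A \<Longrightarrow> weight \<epsilon> h x = 1"
  by (simp add: weight_def)

lemma set_W_index: "x \<in> set_W i \<Longrightarrow> (THE j. x \<in> set_W j) = i"
proof (rule the_equality)
  fix j assume "x \<in> set_W i" "x \<in> set_W j"
  then have "real j < real i + 1" "real i < real j + 1"
    by (auto simp: set_W_def mem_set_U mem_set_V)
  then show "j = i"
    by linarith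
qed

lemma set_W_not_A: "x \<in> set_W j \<Longrightarrow> x \<notin> set_A"
  by (auto simp: set_W_def mem_set_A mem_set_U mem_set_V)

lemma weight_V: "x \<in> set_V j \<Longrightarrow> weight \<epsilon> h x = \<epsilon> j"
  using set_W_index[of x j] set_W_not_A[of x j] by (simp add: weight_def set_W_def)

lemma weight_U:
  assumes "0 < u" "u < 1"
  shows "weight \<epsilon> h (10 * real j + u, u / 2) = min 1 (\<epsilon> j * max (h u) 1)"
proof -
  have U: "(10 * real j + u, u / 2) \<in> set_U j" "(10 * real j + u, u / 2) \<notin> set_V j"
    using assms by (auto simp: mem_set_U mem_set_V)
  then show ?thesis
    using set_W_index[of "(10 * real j + u, u / 2)" j] set_W_not_A[of "(10 * real j + u, u / 2)" j]
    by (simp add: weight_def set_W_def)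
qed

end

theory Submission
  imports Defs "HOL-Real_Asymp.Real_Asymp"
begin

text \<open>
  An open ball around \<open>x\<close> with radius \<open>r > snd x\<close> meets the axis in a full interval of length
  \<open>2 * r\<close>, where the weight is at its maximum 1; such balls satisfy every reverse Hoelder inequality.
  All other balls lie in a single branch \<^term>\<open>set_W j\<close>, and among these only the balls centred in
  \<^term>\<open>set_V j\<close> of radius comparable to 1 see the singularity of \<open>h\<close>: on the remaining ones
  the weight is comparable to a constant. For the exceptional balls the inequality is equivalent, uniformly
  in \<open>j\<close>, to boundedness of the integrals of \<open>(min (1 / \<epsilon> j) (g t)) powr p\<close> over \<open>(0, 1)\<close>.
  As \<open>h t powr p = t powr (- \<alpha> * p) * (1 - ln t) powr (- p)\<close>
  is integrable precisely for \<open>\<alpha> * p \<le> 1\<close>, given \<open>p > 1\<close> (the logarithm pays for the endpoint),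
  this holds iff \<open>p \<le> 1 / \<alpha>\<close>.
\<close>

section \<open>Geometry of the space\<close>

lemma mem_qball_X:
  "y \<in> qball set_X linf x r \<longleftrightarrow> y \<in> set_X \<and> \<bar>fst x - fst y\<bar> < r \<and> \<bar>snd x - snd y\<bar> < r"
  by (auto simp: qball_def linf_eq)

lemma set_A_subset_X: "set_A \<subseteq> set_X"
  and set_U_subset_X: "set_U j \<subseteq> set_X"
  and set_V_subset_X: "set_V j \<subseteq> set_X"
  by (auto simp: set_X_def set_W_def)

lemma A_point_in_X: "(u, 0) \<in> set_X"
  using set_A_subset_X mem_set_A[of "(u, 0)"] by auto

lemma U_point_in_X: "0 < u \<Longrightarrow> u \<le> 1 \<Longrightarrow> (10 * real j + u, u / 2) \<in> set_X"
  using set_U_subset_X[of j] mem_set_U[of "(10 * real j + u, u / 2)" j] by auto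

lemma V_point_in_X: "1/2 \<le> v \<Longrightarrow> v \<le> 1 \<Longrightarrow> (10 * real j + 1, v) \<in> set_X"
  using set_V_subset_X[of j] mem_set_V[of "(10 * real j + 1, v)" j] by auto

section \<open>Measurability of the pieces of the space and of its open sets\<close>

lemma fst_borel [measurable]: "fst \<in> borel_measurable (borel :: (real \<times> real) measure)"
  and snd_borel [measurable]: "snd \<in> borel_measurable (borel :: (real \<times> real) measure)"
  by (intro borel_measurable_continuous_onI continuous_intros)+

lemma set_A_mu: "set_A \<in> sets mu"
proof -
  have "set_A = {x \<in> space borel. snd x = 0}" by (auto simp: mem_set_A)
  also have "\<dots> \<in> sets borel" by measurable
  finally show ?thesis by (auto simp: sets_mu_iff set_X_def)
qed

lemma set_U_mu: "set_U j \<in> sets mu"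
proof -
  have "set_U j = {x \<in> space borel. 0 < fst x - 10 * real j \<and> fst x - 10 * real j \<le> 1 \<and>
     snd x = (fst x - 10 * real j) / 2}" by (auto simp: mem_set_U)
  also have "\<dots> \<in> sets borel" by measurable
  finally show ?thesis by (auto simp: sets_mu_iff set_X_def set_W_def)
qed

lemma set_V_mu: "set_V j \<in> sets mu"
proof -
  have "set_V j = {x \<in> space borel. fst x = 10 * real j + 1 \<and> 1/2 \<le> snd x \<and> snd x \<le> 1}"
    by (auto simp: mem_set_V)
  also have "\<dots> \<in> sets borel" by measurable
  finally show ?thesis by (auto simp: sets_mu_iff set_X_def set_W_def)
qed

text \<open>A union of balls over all points of \<open>G\<close> is uncountable, so measurability
  cannot be obtained ball by ball. Instead \<open>G\<close> is exhibited as the trace on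
  \<open>set_X\<close> of a union of open squares \<open>b x\<close> of the plane, which is open and
  hence Borel.\<close>

lemma open_in_mu:
  assumes "G \<subseteq> set_X" and "\<And>x. x \<in> G \<Longrightarrow> \<exists>r>0. qball set_X linf x r \<subseteq> G"
  shows "G \<in> sets mu"
proof -
  obtain r where r: "\<And>x. x \<in> G \<Longrightarrow> r x > 0 \<and> qball set_X linf x (r x) \<subseteq> G"
    using assms(2) by metis
  define b where "b x = {fst x - r x<..<fst x + r x} \<times> {snd x - r x<..<snd x + r x}" for x
  have "G = set_X \<inter> (\<Union>x\<in>G. b x)"
  proof safe
    fix s t assume "(s, t) \<in> G"
    then show "(s, t) \<in> set_X" "(s, t) \<in> (\<Union>x\<in>G. b x)"
      using assms(1) r[of "(s, t)"] by (auto simp: b_def intro!: bexI[of _ "(s, t)"])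
  next
    fix s t s' t' assume *: "(s, t) \<in> set_X" "(s', t') \<in> G" "(s, t) \<in> b (s', t')"
    then have "(s, t) \<in> qball set_X linf (s', t') (r (s', t'))"
      by (auto simp: b_def mem_qball_X)
    then show "(s, t) \<in> G" using r[OF *(2)] by auto
  qed
  moreover have "open (\<Union>x\<in>G. b x)"
    by (auto simp: b_def intro!: open_Times)
  ultimately show ?thesis
    using set_X_borel assms(1) by (metis sets_mu_iff borel_open sets.Int)
qed

lemma Metric_space_X: "Metric_space set_X linf"
  by unfold_locales (auto simp: linf_eq prod_eq_iff)

lemma qball_mu: "qball set_X linf x r \<in> sets mu"
proof (rule open_in_mu)
  fix y assume y: "y \<in> qball set_X linf x r"
  define s where "s = min (r - \<bar>fst x - fst y\<bar>) (r - \<bar>snd x - snd y\<bar>)"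
  have "s > 0" using y by (auto simp: s_def mem_qball_X)
  moreover have "qball set_X linf y s \<subseteq> qball set_X linf x r"
    by (auto simp: s_def mem_qball_X)
  ultimately show "\<exists>s>0. qball set_X linf y s \<subseteq> qball set_X linf x r" by blast
qed (auto simp: mem_qball_X)

section \<open>Measure of balls: two-sided bounds linear in the radius\<close>

lemma qball_near_A:
  assumes "\<bar>snd x\<bar> < r"
  shows "emeasure mu (set_A \<inter> qball set_X linf x r) \<ge> ennreal (2 * r)"
proof -
  let ?E = "set_A \<inter> qball set_X linf x r"
  have m: "?E \<in> sets mu"
    using set_A_mu qball_mu by blast
  have "(u, 0) \<in> ?E \<longleftrightarrow> fst x - r < u \<and> u < fst x + r" for u
    unfolding Int_iff mem_set_A mem_qball_X using assms A_point_in_X[of u] by (simp; linarith)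
  then have "{u. (u, 0) \<in> ?E} = {fst x - r <..< fst x + r}"
    by (intro set_eqI) (simp only: mem_Collect_eq greaterThanLessThan_iff)
  then have e: "emeasure lborel {u. (u, 0) \<in> ?E} = ennreal (2 * r)"
    by (rule ssubst) (use assms in \<open>subst emeasure_lborel_Ioo; simp\<close>)
  show ?thesis
    unfolding emeasure_mu_explicit[OF m] e  by (rule add_increasing2) auto
qed

text \<open>Only the enclosing interval has to be measurable, so parameter sets of balls can be
  estimated without first proving that they are Borel.\<close>

lemma emeasure_le_interval:
  assumes "S \<subseteq> {a..b::real}" and "b - a \<le> c"
  shows "emeasure lborel S \<le> ennreal c"
proof -
  have "emeasure lborel S \<le> emeasure lborel {a..b}"
    by (intro emeasure_mono assms) auto
  also have "\<dots> \<le> ennreal c"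
    using assms(2) by (auto simp: emeasure_lborel_Icc_eq intro: ennreal_leI)
  finally show ?thesis .
qed

text \<open>The axis contributes at most \<open>2 * r\<close>. All branches together contribute at
  most \<open>4 * r\<close>: each of the two pieces of a branch is at most as long as its window,
  and the windows have total length at most \<open>2 * r\<close>.\<close>

lemma emeasure_qball_le:
  assumes r: "r > 0"
  shows "emeasure mu (qball set_X linf x r) \<le> ennreal (6 * r)"
proof -
  let ?B = "qball set_X linf x r"
  define u where "u j = emeasure lborel {u\<in>{0<..1}. (10 * real j + u, u / 2) \<in> ?B} +
         emeasure lborel {v\<in>{1/2..1}. (10 * real j + 1, v) \<in> ?B}" for j
  define T where "T j = {max (fst x - r) (10 * real j - 4) <..< min (fst x + r) (10 * real j + 5)}" for j
  \<comment> \<open>The two pieces at \<open>j\<close> are charged to the window \<open>T j\<close>; the windows are disjoint in an interval of length \<open>2 * r\<close>.\<close>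
  have u: "u j \<le> 2 * emeasure lborel (T j)" for j
  proof (cases "fst x - r < 10 * real j + 1 \<and> 10 * real j < fst x + r")
    case True
    \<comment> \<open>\<open>c\<close> is the length of the window \<open>T j\<close>. The
      untruncated window reaches 4 beyond the projection of the branch on both sides, so a ball
      whose projection meets that of the branch keeps length at least \<open>min 4 (2 * r)\<close>
      in it. Each piece has length at most \<open>2 * r\<close> when \<open>2 * r \<le> 1\<close>,
      and at most 1 otherwise; \<open>c\<close> dominates both.\<close>
    define c where "c = min (fst x + r) (10 * real j + 5) - max (fst x - r) (10 * real j - 4)"
    have c: "min 4 (2 * r) \<le> c" "0 \<le> c"
      using True r by (auto simp: c_def)
    have 1: "emeasure lborel {u\<in>{0<..1}. (10 * real j + u, u / 2) \<in> ?B} \<le> ennreal c"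
    proof (cases "2 * r \<le> 1")
      case True
      then show ?thesis using c(1)
        by (intro emeasure_le_interval[where a = "fst x - 10 * real j - r" and
              b = "fst x - 10 * real j + r"]) (auto simp: mem_qball_X)
    next
      case False
      then show ?thesis using c(1)
        by (intro emeasure_le_interval[where a = 0 and b = 1]) auto
    qed
    have 2: "emeasure lborel {v\<in>{1/2..1}. (10 * real j + 1, v) \<in> ?B} \<le> ennreal c"
    proof (cases "2 * r \<le> 1")
      case True
      then show ?thesis using c(1)
        by (intro emeasure_le_interval[where a = "snd x - r" and b = "snd x + r"])
           (auto simp: mem_qball_X)
    next
      case False
      then show ?thesis using c(1)
        by (intro emeasure_le_interval[where a = 0 and b = 1]) auto
    qed
    have "emeasure lborel (T j) = ennreal c"
      using c(2) by (simp add: T_def c_def emeasure_lborel_Ioo)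
    then show ?thesis
      using add_mono[OF 1 2] by (simp add: u_def mult_2)
  next
    case False
    then have "{u\<in>{0<..1}. (10 * real j + u, u / 2) \<in> ?B} = {}"
      "{v\<in>{1/2..1}. (10 * real j + 1, v) \<in> ?B} = {}"
      by (auto simp: mem_qball_X)
    then show ?thesis unfolding u_def by (metis add_0 emeasure_empty zero_le)
  qed
  have disj: "disjoint_family T"
  proof -
    have "i = j" if "y \<in> T i" "y \<in> T j" for i j y
    proof -
      have "real i < real j + 1" "real j < real i + 1" using that by (auto simp: T_def)
      then show ?thesis by linarith
    qed
    then show ?thesis by (auto simp: disjoint_family_on_def)
  qed
  have "(\<Sum>j. u j) \<le> (\<Sum>j. 2 * emeasure lborel (T j))"
    by (intro suminf_le u) auto
  also have "\<dots> = 2 * emeasure lborel (\<Union>j. T j)"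
    by (subst suminf_emeasure[symmetric]) (auto simp: disj T_def)
  also have "\<dots> \<le> ennreal 2 * ennreal (2 * r)"
    unfolding ennreal_numeral
    by (intro mult_left_mono emeasure_le_interval[where a = "fst x - r" and b = "fst x + r"])
       (auto simp: T_def)
  also have "\<dots> = ennreal (2 * (2 * r))"
    using r by (intro ennreal_mult[symmetric]) auto
  finally have s: "(\<Sum>j. u j) \<le> ennreal (4 * r)"
    by simp
  have A: "emeasure lborel {u. (u, 0) \<in> ?B} \<le> ennreal (2 * r)"
    by (intro emeasure_le_interval[where a = "fst x - r" and b = "fst x + r"])
       (auto simp: mem_qball_X)
  have "emeasure mu ?B \<le> ennreal (2 * r) + ennreal (4 * r)"
    unfolding emeasure_mu_explicit[OF qball_mu] using add_mono[OF A s] by (simp add: u_def)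
  also have "\<dots> = ennreal (6 * r)"
    using r by (simp flip: ennreal_plus)
  finally show ?thesis .
qed

lemma emeasure_mu_ge:
  assumes "E \<in> sets mu"
  shows "emeasure lborel {u\<in>{0<..1}. (10 * real j + u, u / 2) \<in> E} \<le> emeasure mu E"
    and "emeasure lborel {v\<in>{1/2..1}. (10 * real j + 1, v) \<in> E} \<le> emeasure mu E"
proof -
  let ?u = "\<lambda>j. emeasure lborel {u\<in>{0<..1}. (10 * real j + u, u / 2) \<in> E} +
         emeasure lborel {v\<in>{1/2..1}. (10 * real j + 1, v) \<in> E}"
  have "?u j \<le> (\<Sum>j. ?u j)"
    using sum_le_suminf[of ?u "{j}"] by simp
  also have "\<dots> \<le> emeasure mu E"
    unfolding emeasure_mu_explicit[OF assms] by (simp add: add_increasing)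
  finally have *: "?u j \<le> emeasure mu E" .
  show "emeasure lborel {u\<in>{0<..1}. (10 * real j + u, u / 2) \<in> E} \<le> emeasure mu E"
    by (rule order_trans[OF _ *]) simp
  show "emeasure lborel {v\<in>{1/2..1}. (10 * real j + 1, v) \<in> E} \<le> emeasure mu E"
    by (rule order_trans[OF _ *]) simp
qed

text \<open>Each ball contains a segment of length comparable to \<open>r\<close> through its centre
  or on the axis. The factor 1/6 is not sharp; it is the reciprocal of the constant in
  \<open>emeasure_qball_le\<close>, so that 6 serves for both bounds of Ahlfors regularity.\<close>

lemma emeasure_qball_ge:
  assumes x: "x \<in> set_X" and r: "r > 0"
  shows "ennreal (r / 6) \<le> emeasure mu (qball set_X linf x r)"
proof -
  let ?B = "qball set_X linf x r"
  consider "\<bar>snd x\<bar> < r" | j where "x \<in> set_U j" "r \<le> snd x" | j where "x \<in> set_V j" "r \<le> snd x"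
    using x r by (force simp: set_X_def set_W_def mem_set_A mem_set_U mem_set_V)
  then show ?thesis
  proof cases
    case 1
    have "ennreal (r / 6) \<le> ennreal (2 * r)"
      using r by (intro ennreal_leI) auto
    also have "\<dots> \<le> emeasure mu (set_A \<inter> ?B)"
      by (rule qball_near_A[OF 1])
    also have "\<dots> \<le> emeasure mu ?B"
      by (intro emeasure_mono qball_mu) auto
    finally show ?thesis .
  next
    case (2 j)
    define u where "u = fst x - 10 * real j"
    have x: "x = (10 * real j + u, u / 2)" "0 < u" "u \<le> 1" "r \<le> u / 2"
      using 2 by (auto simp: u_def mem_set_U prod_eq_iff)
    \<comment> \<open>The interval is taken to the left of \<open>u\<close> only, since
      \<open>u\<close> may be the end point 1; it stays in the parameter range because
      \<open>r \<le> u / 2\<close>.\<close>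
    have "ennreal (r / 6) \<le> emeasure lborel {u - r <.. u}"
      using r by (simp add: ennreal_leI)
    also have "\<dots> \<le> emeasure lborel {u\<in>{0<..1}. (10 * real j + u, u / 2) \<in> ?B}"
    proof (rule emeasure_mono)
      have "(\<lambda>u. (10 * real j + u, u / 2)) \<in> borel_measurable borel"
        by (intro borel_measurable_continuous_onI continuous_intros) auto
      then have "(\<lambda>u. (10 * real j + u, u / 2)) -` ?B \<inter> space borel \<in> sets borel"
        using qball_mu[of x r] by (intro measurable_sets[where A = borel]) (auto simp: sets_mu_iff)
      then have "{0<..1} \<inter> (\<lambda>u. (10 * real j + u, u / 2)) -` ?B \<in> sets borel"
        by (intro sets.Int) auto
      then show "{u\<in>{0<..1}. (10 * real j + u, u / 2) \<in> ?B} \<in> sets lborel"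
        by (simp add: Int_def)
      show "{u - r<..u} \<subseteq> {u\<in>{0<..1}. (10 * real j + u, u / 2) \<in> ?B}"
        using x by (auto simp: mem_qball_X U_point_in_X)
    qed
    also have "\<dots> \<le> emeasure mu ?B"
      by (rule emeasure_mu_ge[OF qball_mu])
    finally show ?thesis .
  next
    case (3 j)
    define v where "v = snd x"
    have x: "x = (10 * real j + 1, v)" "1/2 \<le> v" "v \<le> 1" "r \<le> 1"
      using 3 by (auto simp: v_def mem_set_V prod_eq_iff)
    \<comment> \<open>Truncation to [1/2, 1] cuts at most one of the two halves, because
      \<open>r / 6\<close> is at most 1/6 and the segment has length 1/2.\<close>
    have "ennreal (r / 6) \<le> emeasure lborel {max (1/2) (v - r / 6) <..< min 1 (v + r / 6)}"
      using r x by (subst emeasure_lborel_Ioo) (auto simp: min_def max_def intro!: ennreal_leI)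
    also have "\<dots> \<le> emeasure lborel {v\<in>{1/2..1}. (10 * real j + 1, v) \<in> ?B}"
    proof (rule emeasure_mono)
      have "(\<lambda>v. (10 * real j + 1, v)) \<in> borel_measurable borel"
        by (intro borel_measurable_continuous_onI continuous_intros)
      then have "(\<lambda>v. (10 * real j + 1, v)) -` ?B \<inter> space borel \<in> sets borel"
        using qball_mu[of x r] by (intro measurable_sets[where A = borel]) (auto simp: sets_mu_iff)
      then have "{1/2..1} \<inter> (\<lambda>v. (10 * real j + 1, v)) -` ?B \<in> sets borel"
        by (intro sets.Int) auto
      then show "{v\<in>{1/2..1}. (10 * real j + 1, v) \<in> ?B} \<in> sets lborel"
        by (simp add: Int_def)
      show "{max (1/2) (v - r / 6) <..< min 1 (v + r / 6)} \<subseteq> {v\<in>{1/2..1}. (10 * real j + 1, v) \<in> ?B}"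
        using x r by (auto simp: mem_qball_X V_point_in_X)
    qed
    also have "\<dots> \<le> emeasure mu ?B"
      by (rule emeasure_mu_ge[OF qball_mu])
    finally show ?thesis .
  qed
qed

lemma Ahlfors_regular_X: "Ahlfors_regular 1 set_X linf mu"
  unfolding Ahlfors_regular_def
  by (rule exI[of _ 6]) (auto simp: emeasure_qball_ge emeasure_qball_le)

lemma homogeneous_type_X: "homogeneous_type set_X linf mu"
  unfolding homogeneous_type_def
proof (intro conjI ballI allI impI)
  interpret Metric_space set_X linf by (rule Metric_space_X)
  show "quasi_metric_on set_X linf"
    unfolding quasi_metric_on_def using commute triangle by (auto intro!: exI[of _ 1])
  show "space mu = set_X" by simp
  show "G \<in> sets mu" if "G \<subseteq> set_X" "\<forall>x\<in>G. \<exists>r>0. qball set_X linf x r \<subseteq> G" for G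
    using that by (intro open_in_mu) auto
  fix x r assume x: "x \<in> set_X" and r: "r > (0::real)"
  show "qball set_X linf x r \<in> sets mu" by (rule qball_mu)
  show "0 < emeasure mu (qball set_X linf x r)"
    using emeasure_qball_ge[OF x r] r by (metis divide_pos_pos ennreal_less_zero_iff less_le_trans zero_less_numeral)
  show "emeasure mu (qball set_X linf x r) < \<infinity>"
    using le_less_trans[OF emeasure_qball_le[OF r] ennreal_less_top] by simp
next
  show "\<exists>C. \<forall>x\<in>set_X. \<forall>r>0. emeasure mu (qball set_X linf x (2 * r))
          \<le> ennreal C * emeasure mu (qball set_X linf x r)"
  \<comment> \<open>72 is the quotient of the upper bound \<open>6 * (2 * r)\<close> by the lower
    bound \<open>r / 6\<close>.\<close>
  proof (intro exI[of _ 72] ballI allI impI)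
    fix x r assume x: "x \<in> set_X" and r: "r > (0::real)"
    have "emeasure mu (qball set_X linf x (2 * r)) \<le> ennreal (6 * (2 * r))"
      using r by (intro emeasure_qball_le) auto
    also have "\<dots> = ennreal 72 * ennreal (r / 6)"
      using r by (subst ennreal_mult[symmetric]) auto
    also have "\<dots> \<le> ennreal 72 * emeasure mu (qball set_X linf x r)"
      by (intro mult_left_mono emeasure_qball_ge x r) auto
    finally show "emeasure mu (qball set_X linf x (2 * r))
          \<le> ennreal 72 * emeasure mu (qball set_X linf x r)" .
  qed
qed

section \<open>Reverse Hoelder inequalities on a single ball\<close>

lemma ennreal_powr_le_iff:
  assumes "q > 0" "b \<ge> 0"
  shows "ennreal_powr x (1 / q) \<le> ennreal b \<longleftrightarrow> x \<le> ennreal (b powr q)"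
proof (cases x)
  case (real r)
  have "r powr (1 / q) \<le> b \<longleftrightarrow> r \<le> b powr q"
  proof
    assume "r powr (1 / q) \<le> b"
    then have "(r powr (1 / q)) powr q \<le> b powr q"
      using assms by (intro powr_mono2) auto
    then show "r \<le> b powr q" using assms real by (simp add: powr_powr)
  next
    assume "r \<le> b powr q"
    then have "r powr (1 / q) \<le> (b powr q) powr (1 / q)"
      using assms real by (intro powr_mono2) auto
    then show "r powr (1 / q) \<le> b" using assms by (simp add: powr_powr)
  qed
  then show ?thesis
    using real assms by (simp add: ennreal_powr_def)
next
  case top
  then show ?thesis
    by (simp add: ennreal_powr_def top_unique)
qed

text \<open>The inequality is split at an intermediate value \<open>a\<close>: the power mean is at
  most \<open>a\<close>, and \<open>a\<close> is at most \<open>C\<close> times the mean. Both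
  halves are stated as integrals against a multiple of the measure of the ball, which avoids
  quotients of extended reals.\<close>

lemma reverse_Hoelder_ballI:
  assumes q: "q > 0" and a: "a \<ge> 0"
    and B: "emeasure M B \<noteq> 0" "emeasure M B < \<infinity>"
    and upper: "(\<integral>\<^sup>+y\<in>B. ennreal (w y powr q) \<partial>M) \<le> ennreal (a powr q) * emeasure M B"
    and lower: "ennreal a * emeasure M B \<le> ennreal C * (\<integral>\<^sup>+y\<in>B. ennreal (w y) \<partial>M)"
  shows "ennreal_powr (average M B (\<lambda>y. w y powr q)) (1 / q) \<le> ennreal C * average M B w"
proof -
  have "average M B (\<lambda>y. w y powr q) \<le> ennreal (a powr q) * emeasure M B / emeasure M B"
    unfolding average_def by (intro divide_right_mono_ennreal upper)
  also have "\<dots> = ennreal (a powr q)"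
    using B by (intro mult_divide_eq_ennreal) auto
  finally have "ennreal_powr (average M B (\<lambda>y. w y powr q)) (1 / q) \<le> ennreal a"
    using q a by (simp add: ennreal_powr_le_iff)
  also have "\<dots> = ennreal a * emeasure M B / emeasure M B"
    using B by (intro mult_divide_eq_ennreal[symmetric]) auto
  also have "\<dots> \<le> ennreal C * average M B w"
    unfolding average_def ennreal_times_divide by (intro divide_right_mono_ennreal lower)
  finally show ?thesis .
qed

text \<open>The intermediate value is the upper bound \<open>C * m\<close>. The resulting constant
  \<open>C\<close> depends neither on \<open>q\<close> nor on the level \<open>m\<close>, hence
  later not on the size of \<open>\<epsilon> j\<close>.\<close>

lemma reverse_Hoelder_ball_comparable:
  assumes q: "q > 0" and m: "m \<ge> 0" and C: "C \<ge> 0"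
    and B: "B \<in> sets M" "emeasure M B \<noteq> 0" "emeasure M B < \<infinity>"
    and w: "w \<in> borel_measurable M"
    and bounds: "\<And>y. y \<in> B \<Longrightarrow> m \<le> w y \<and> w y \<le> C * m"
  shows "ennreal_powr (average M B (\<lambda>y. w y powr q)) (1 / q) \<le> ennreal C * average M B w"
proof (rule reverse_Hoelder_ballI[where a = "C * m", OF q _ B(2,3)])
  have "(\<integral>\<^sup>+y\<in>B. ennreal (w y powr q) \<partial>M) \<le> (\<integral>\<^sup>+y\<in>B. ennreal ((C * m) powr q) \<partial>M)"
    using bounds m q by (intro nn_integral_mono)
      (force split: split_indicator intro!: ennreal_leI powr_mono2)
  also have "\<dots> = ennreal ((C * m) powr q) * emeasure M B"
    using B by (intro nn_integral_cmult_indicator) auto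
  finally show "(\<integral>\<^sup>+y\<in>B. ennreal (w y powr q) \<partial>M) \<le> ennreal ((C * m) powr q) * emeasure M B" .
  have "ennreal (C * m) * emeasure M B = ennreal C * (\<integral>\<^sup>+y\<in>B. ennreal m \<partial>M)"
    using B C m by (subst nn_integral_cmult_indicator) (auto simp: ennreal_mult mult.assoc)
  also have "\<dots> \<le> ennreal C * (\<integral>\<^sup>+y\<in>B. ennreal (w y) \<partial>M)"
    using bounds by (intro mult_left_mono nn_integral_mono)
      (auto split: split_indicator intro!: ennreal_leI)
  finally show "ennreal (C * m) * emeasure M B \<le> ennreal C * (\<integral>\<^sup>+y\<in>B. ennreal (w y) \<partial>M)" .
qed (use m C in auto)

section \<open>The profile function\<close>

definition profile :: "real \<Rightarrow> real \<Rightarrow> real" where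
  "profile \<alpha> = (\<lambda>t. t powr (- \<alpha>) * inverse (ln (exp 1 / t)))"

lemma profile_eq: "t > 0 \<Longrightarrow> profile \<alpha> t = t powr (- \<alpha>) / (1 - ln t)"
  by (simp add: profile_def ln_div divide_inverse[of _ "1 - ln t"])

lemma profile_measurable [measurable]: "profile \<alpha> \<in> borel_measurable borel"
  unfolding profile_def by measurable

lemma one_minus_ln_ge_1: "0 < t \<Longrightarrow> t \<le> 1 \<Longrightarrow> 1 \<le> 1 - ln (t::real)"
  by simp

lemma ln_3_le: "ln (3::real) \<le> 2"
  using ln_le_minus_one[of "3::real"] by simp

text \<open>Changing the argument by a factor of at most 3 costs
  \<open>3 powr \<alpha> \<le> 3\<close> in the power. It costs another 3 in the logarithm, since
  \<open>ln 3 \<le> 2\<close> and \<open>1 - ln t\<close> is at least 1. This gives 9.\<close>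

lemma profile_compare:
  assumes "0 < \<alpha>" "\<alpha> < 1" "0 < s" "s \<le> 1" "0 < t" "t \<le> 1" "s \<le> 3 * t" "t \<le> 3 * s"
  shows "profile \<alpha> t \<le> 9 * profile \<alpha> s"
proof -
  have "t powr (- \<alpha>) \<le> (s / 3) powr (- \<alpha>)"
    using assms by (intro powr_mono2') auto
  also have "\<dots> = 3 powr \<alpha> * s powr (- \<alpha>)"
    using assms by (simp add: powr_divide powr_minus field_simps)
  also have "\<dots> \<le> 3 powr 1 * s powr (- \<alpha>)"
    using assms by (intro mult_right_mono powr_mono) auto
  finally have 1: "t powr (- \<alpha>) \<le> 3 * s powr (- \<alpha>)" by simp
  have "ln t \<le> ln (3 * s)"
    using assms by (subst ln_le_cancel_iff) auto
  also have "\<dots> = ln 3 + ln s"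
    using assms by (subst ln_mult) auto
  finally have "1 - ln s \<le> ln 3 + (1 - ln t)" by simp
  also have "\<dots> \<le> 3 * (1 - ln t)"
  proof -
    have "a + b \<le> 3 * b" if "a \<le> 2" "1 \<le> b" for a b :: real
      using that by simp
    then show ?thesis using ln_3_le one_minus_ln_ge_1[OF \<open>0 < t\<close> \<open>t \<le> 1\<close>] .
  qed
  finally have 2: "1 / (1 - ln t) \<le> 3 / (1 - ln s)"
    using one_minus_ln_ge_1[OF \<open>0 < t\<close> \<open>t \<le> 1\<close>] one_minus_ln_ge_1[OF \<open>0 < s\<close> \<open>s \<le> 1\<close>]
    by (subst frac_le_eq) (auto intro!: divide_nonpos_pos mult_pos_pos)
  have "t powr (- \<alpha>) * (1 / (1 - ln t)) \<le> 3 * s powr (- \<alpha>) * (3 / (1 - ln s))"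
    using one_minus_ln_ge_1[OF \<open>0 < t\<close> \<open>t \<le> 1\<close>] by (intro mult_mono 1 2) auto
  then show ?thesis
    using assms by (simp add: profile_eq)
qed

lemma profile_le_3:
  assumes "0 < \<alpha>" "\<alpha> < 1" "1 / 3 \<le> t" "t \<le> 1"
  shows "profile \<alpha> t \<le> 3"
proof -
  have "t powr (- \<alpha>) \<le> (1 / 3) powr (- \<alpha>)"
    using assms by (intro powr_mono2') auto
  also have "\<dots> = 3 powr \<alpha>"
    by (simp add: powr_minus powr_divide)
  also have "\<dots> \<le> 3 powr 1"
    using assms by (intro powr_mono) auto
  finally have 1: "t powr (- \<alpha>) \<le> 3" by simp
  have "t powr (- \<alpha>) / (1 - ln t) \<le> 3 / 1"
    using one_minus_ln_ge_1[of t] assms 1 by (intro frac_le) auto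
  then show ?thesis using assms by (simp add: profile_eq)
qed

text \<open>The integrand has the antiderivative \<open>F\<close>, which tends to 0 at 0 because
  \<open>1 - ln t\<close> tends to infinity and the exponent \<open>1 - q\<close> is
  negative.\<close>

lemma nn_integral_inverse_log_powr:
  assumes q: "q > 1"
  shows "(\<integral>\<^sup>+t\<in>{0<..<1}. ennreal ((1 - ln t) powr (- q) / t) \<partial>lborel) < \<infinity>"
proof -
  define F where "F t = (1 - ln t) powr (1 - q) / (q - 1)" for t :: real
  let ?f = "\<lambda>t::real. (1 - ln t) powr (- q) / t"
  have F: "(F has_real_derivative ?f t) (at t)" if "0 < t" "t < 1" for t
  proof -
    have "1 - ln t > 0" using that by (simp add: less_trans[of _ 0 1])
    then have "((\<lambda>z. z powr (1 - q)) has_real_derivative (1 - q) * (1 - ln t) powr (1 - q - 1)) (at (1 - ln t))"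
      by (rule has_real_derivative_powr)
    moreover have "((\<lambda>t. 1 - ln t) has_real_derivative - (1 / t)) (at t)"
      using that by (auto intro!: derivative_eq_intros)
    ultimately have "((\<lambda>t. (1 - ln t) powr (1 - q)) has_real_derivative
        (1 - q) * (1 - ln t) powr (1 - q - 1) * - (1 / t)) (at t)"
      by (rule DERIV_chain2)
    then have "(F has_real_derivative (1 - q) * (1 - ln t) powr (1 - q - 1) * - (1 / t) / (q - 1)) (at t)"
      unfolding F_def by (rule DERIV_cdivide)
    also have "(1 - q) * (1 - ln t) powr (1 - q - 1) * - (1 / t) / (q - 1) = ?f t"
      using that q by (simp add: field_simps)
    finally show ?thesis .
  qed
  have cont: "isCont ?f t" if "0 < t" "t < 1" for t
  proof -
    have "1 - ln t > 0" using that by (simp add: less_trans[of _ 0 1])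
    then show ?thesis using that by (intro continuous_intros) auto
  qed
  have "set_integrable lborel (einterval (ereal 0) (ereal 1)) ?f"
  proof (rule interval_integral_FTC_nonneg(1)[where F = F])
    have "((\<lambda>t. (1 - ln t) powr (1 - q)) \<longlongrightarrow> 0) (at_right 0)"
    proof (rule tendsto_neg_powr)
      show "filterlim (\<lambda>t::real. 1 - ln t) at_top (at_right 0)"
        by real_asymp
    qed (use q in auto)
    then have "(F \<longlongrightarrow> 0 / (q - 1)) (at_right 0)"
      unfolding F_def by (intro tendsto_divide) (use q in auto)
    then show "((F \<circ> real_of_ereal) \<longlongrightarrow> 0) (at_right (ereal 0))"
      by (simp add: ereal_tendsto_simps)
    have "(F \<longlongrightarrow> F 1) (at_left 1)"
      unfolding F_def by (intro tendsto_intros) (use q in auto)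
    then show "((F \<circ> real_of_ereal) \<longlongrightarrow> F 1) (at_left (ereal 1))"
      by (simp add: ereal_tendsto_simps)
  qed (auto intro!: F cont AE_I2)
  then have "integrable lborel (\<lambda>t. indicator {0<..<1} t *\<^sub>R ?f t)"
    by (simp add: set_integrable_def)
  then have "(\<integral>\<^sup>+t. norm (indicator {0<..<1} t *\<^sub>R ?f t) \<partial>lborel) < \<infinity>"
    by (simp add: integrable_iff_bounded)
  also have "(\<integral>\<^sup>+t. norm (indicator {0<..<1} t *\<^sub>R ?f t) \<partial>lborel) =
      (\<integral>\<^sup>+t\<in>{0<..<1}. ennreal (?f t) \<partial>lborel)"
    by (intro nn_integral_cong) (auto split: split_indicator)
  finally show ?thesis .
qed

text \<open>On the unit interval \<open>t powr (- (\<alpha> * q))\<close> is at most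
  \<open>1 / t\<close> as long as \<open>\<alpha> * q \<le> 1\<close>, the case of equality
  included; the logarithmic factor then makes the bound integrable. The maximum with 1 adds at most
  1 to the integral.\<close>

lemma nn_integral_profile_powr:
  assumes \<alpha>: "0 < \<alpha>" and q: "q > 1" "\<alpha> * q \<le> 1"
  shows "(\<integral>\<^sup>+t\<in>{0<..1}. ennreal (max (profile \<alpha> t) 1 powr q) \<partial>lborel) < \<infinity>"
proof -
  have bound: "max (profile \<alpha> t) 1 powr q \<le> (1 - ln t) powr (- q) / t + 1" if t: "0 < t" "t < 1" for t
  proof -
    have l: "1 - ln t > 0" using t by (simp add: less_trans[of _ 0 1])
    have "profile \<alpha> t powr q = t powr (- (\<alpha> * q)) * (1 - ln t) powr (- q)"
      unfolding profile_eq[OF t(1)] using t l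
      by (subst powr_divide)
        (simp_all only: powr_powr powr_minus[of "1 - ln t"] divide_inverse mult_minus_left)
    also have "\<dots> \<le> t powr (- 1) * (1 - ln t) powr (- q)"
      using t q by (intro mult_right_mono powr_mono') auto
    also have "\<dots> = (1 - ln t) powr (- q) / t"
      using t by (simp add: powr_minus divide_inverse)
    finally have "profile \<alpha> t powr q \<le> (1 - ln t) powr (- q) / t" .
    then show ?thesis
      using t by (auto simp: max_def)
  qed
  have "(\<integral>\<^sup>+t\<in>{0<..1}. ennreal (max (profile \<alpha> t) 1 powr q) \<partial>lborel) \<le>
      (\<integral>\<^sup>+t. ennreal ((1 - ln t) powr (- q) / t) * indicator {0<..<1} t + indicator {0<..<1} t \<partial>lborel)"
  proof (rule nn_integral_mono_AE)
    \<comment> \<open>The end point 1 enters through the parametrisation of \<open>set_U\<close>;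
      the pointwise bound is for the open interval, and a single point is null.\<close>
    have "AE t in lborel. t \<noteq> (1::real)" by (rule AE_lborel_singleton)
    then show "AE t in lborel. ennreal (max (profile \<alpha> t) 1 powr q) * indicator {0<..1} t \<le>
      ennreal ((1 - ln t) powr (- q) / t) * indicator {0<..<1} t + indicator {0<..<1} t"
    proof eventually_elim
      case (elim t)
      show ?case
      proof (cases "0 < t \<and> t < 1")
        case True
        then have "ennreal (max (profile \<alpha> t) 1 powr q) \<le> ennreal ((1 - ln t) powr (- q) / t + 1)"
          using bound by (intro ennreal_leI) auto
        also have "\<dots> = ennreal ((1 - ln t) powr (- q) / t) + 1"
          using True by (subst ennreal_plus) auto
        finally show ?thesis using True by simp
      qed (use elim in auto)
    qed
  qed
  also have "\<dots> = (\<integral>\<^sup>+t\<in>{0<..<1}. ennreal ((1 - ln t) powr (- q) / t) \<partial>lborel) + 1"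
    by (subst nn_integral_add) auto
  also have "\<dots> < \<infinity>"
    using nn_integral_inverse_log_powr[OF q(1)] by simp
  finally show ?thesis .
qed

text \<open>The surplus exponent \<open>\<delta> = \<alpha> - 1 / p\<close> is positive, and
  \<open>t powr \<delta>\<close> beats the logarithm near 0. Thus the \<open>p\<close>-th power of
  the profile dominates \<open>1 / t\<close>, whose integral diverges at 0.\<close>

lemma profile_powr_large:
  assumes "0 < \<alpha>" "\<alpha> * p > 1"
  obtains t0 where "0 < t0" "t0 < 1" "\<And>t. 0 < t \<Longrightarrow> t < t0 \<Longrightarrow> 1 / t \<le> profile \<alpha> t powr p"
proof -
  have p: "p > 0" using assms by (metis less_trans zero_less_mult_pos zero_less_one)
  define \<delta> where "\<delta> = (\<alpha> * p - 1) / p"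
  have \<delta>: "\<delta> > 0" using assms p by (simp add: \<delta>_def)
  have "((\<lambda>t::real. t powr \<delta> * (1 - ln t)) \<longlongrightarrow> 0) (at_right 0)"
    using \<delta> by real_asymp
  then have "eventually (\<lambda>t::real. t powr \<delta> * (1 - ln t) < 1) (at_right 0)"
    by (rule order_tendstoD) simp
  then obtain b where b: "b > 0" "\<And>t. 0 < t \<Longrightarrow> t < b \<Longrightarrow> t powr \<delta> * (1 - ln t) < (1::real)"
    by (auto simp: eventually_at_right_field)
  show ?thesis
  proof (rule that[of "min b (1/2)"])
    fix t :: real assume t: "0 < t" "t < min b (1/2)"
    have l: "1 - ln t > 0" using t by (simp add: less_trans[of _ 0 1])
    have "1 / t = (t powr (- (1 / p))) powr p"
    proof -
      have "- (1 / p) * p = - 1" using p by simp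
      then show ?thesis
        unfolding powr_powr using t by (simp only: powr_neg_one)
    qed
    also have "\<dots> \<le> profile \<alpha> t powr p"
    proof (rule powr_mono2)
      have "t powr (- (1 / p)) = t powr (- \<alpha>) * t powr \<delta>"
      proof -
        have "- (1 / p) = - \<alpha> + \<delta>" using p by (simp add: \<delta>_def diff_divide_distrib)
        then show ?thesis by (simp only: powr_add)
      qed
      also have "\<dots> \<le> t powr (- \<alpha>) * (1 / (1 - ln t))"
        using b(2)[of t] t l by (intro mult_left_mono) (auto simp: field_simps)
      finally show "t powr (- (1 / p)) \<le> profile \<alpha> t"
        using t by (simp add: profile_eq)
    qed (use p in auto)
    finally show "1 / t \<le> profile \<alpha> t powr p" .
  qed (use b in auto)
qed

lemma mem_set_X: "x \<in> set_X \<longleftrightarrow> x \<in> set_A \<or> (\<exists>j. x \<in> set_W j)"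
  by (simp add: set_X_def)

section \<open>The weight\<close>

text \<open>The definition by \<open>THE\<close> is not visibly measurable. On \<open>set_X\<close>
  it agrees with the Borel function \<open>W\<close>, in which the index is read off as the integer
  part of \<open>fst x / 10\<close>, and \<open>set_V j\<close> is recognised inside its branch by
  \<open>fst x = 10 * real j + 1\<close>, corner included.\<close>

lemma weight_measurable:
  assumes [measurable]: "h \<in> borel_measurable borel"
  shows "weight \<epsilon> h \<in> borel_measurable mu"
proof -
  define W where "W x = (let j = nat \<lfloor>fst x / 10\<rfloor> in
    if snd x = 0 then 1 else if fst x = 10 * real j + 1 then \<epsilon> j
    else min 1 (\<epsilon> j * max (h (fst x - 10 * real j)) 1))" for x :: "real \<times> real"
  have "W \<in> borel_measurable borel"
    unfolding W_def Let_def by measurable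
  then have "W \<in> borel_measurable (restrict_space borel set_X)"
    by (rule measurable_restrict_space1)
  then have "W \<in> borel_measurable mu"
    by (simp cong: measurable_cong_sets add: sets_mu)
  moreover have "weight \<epsilon> h x = W x" if X: "x \<in> set_X" for x
  proof (cases "x \<in> set_A")
    case True
    then show ?thesis by (simp add: weight_A W_def mem_set_A)
  next
    case False
    then obtain j where j: "x \<in> set_U j \<or> x \<in> set_V j"
      using X by (auto simp: mem_set_X set_W_def)
    then have "\<lfloor>fst x / 10\<rfloor> = int j"
      by (intro floor_unique) (auto simp: mem_set_U mem_set_V)
    then have n: "nat \<lfloor>fst x / 10\<rfloor> = j" by simp
    have nz: "snd x \<noteq> 0"
      using False by (simp add: mem_set_A)
    show ?thesis
    proof (cases "fst x = 10 * real j + 1")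
      case True
      then have "x \<in> set_V j" using j by (auto simp: mem_set_U mem_set_V)
      then show ?thesis using nz True n by (simp add: W_def weight_V)
    next
      case False
      then have u: "x \<in> set_U j" "x \<notin> set_V j" using j by (auto simp: mem_set_V)
      define u where "u = fst x - 10 * real j"
      have "x = (10 * real j + u, u / 2)" "0 < u" "u < 1"
        using u(1) False by (auto simp: u_def mem_set_U prod_eq_iff)
      then show ?thesis
        using nz n weight_U[of u \<epsilon> h j] False by (simp add: W_def Let_def)
    qed
  qed
  ultimately show ?thesis
    by (subst measurable_cong[where g = W]) simp_all
qed

text \<open>The upper bound without the cap at 1 is meant for all of \<open>set_W j\<close>. On
  \<open>set_V j\<close> it evaluates \<open>h\<close> at 1, where nothing is assumed about
  \<open>h\<close>; the maximum with 1 keeps it true.\<close>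

lemma weight_W:
  assumes "x \<in> set_W j" "0 < \<epsilon> j" "\<epsilon> j \<le> 1"
  shows "\<epsilon> j \<le> weight \<epsilon> h x" "weight \<epsilon> h x \<le> \<epsilon> j * max (h (fst x - 10 * real j)) 1"
    "weight \<epsilon> h x \<le> 1"
proof -
  have "\<epsilon> j \<le> weight \<epsilon> h x \<and> weight \<epsilon> h x \<le> \<epsilon> j * max (h (fst x - 10 * real j)) 1 \<and> weight \<epsilon> h x \<le> 1"
  proof (cases "x \<in> set_V j")
    case True
    have "\<epsilon> j * 1 \<le> \<epsilon> j * max (h (fst x - 10 * real j)) 1"
      using assms by (intro mult_left_mono) auto
    then show ?thesis using assms True by (simp add: weight_V)
  next
    case False
    define u where "u = fst x - 10 * real j"
    have U: "x \<in> set_U j" using assms False by (auto simp: set_W_def)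
    have "u \<noteq> 1"
    proof
      assume "u = 1"
      then have "x \<in> set_V j" using U by (auto simp: u_def mem_set_U mem_set_V)
      then show False using False by simp
    qed
    then have u: "x = (10 * real j + u, u / 2)" "0 < u" "u < 1"
      using U by (auto simp: u_def mem_set_U prod_eq_iff)
    have "\<epsilon> j * 1 \<le> \<epsilon> j * max (h u) 1"
      using assms by (intro mult_left_mono) auto
    then show ?thesis
      using weight_U[OF u(2,3), of \<epsilon> h j] assms u(1) by auto
  qed
  then show "\<epsilon> j \<le> weight \<epsilon> h x" "weight \<epsilon> h x \<le> \<epsilon> j * max (h (fst x - 10 * real j)) 1"
    "weight \<epsilon> h x \<le> 1" by auto
qed

lemma weight_bounds:
  assumes "\<And>j. 0 < \<epsilon> j" "\<And>j. \<epsilon> j \<le> 1" "x \<in> set_X"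
  shows "0 \<le> weight \<epsilon> h x" "weight \<epsilon> h x \<le> 1"
proof -
  consider "x \<in> set_A" | j where "x \<in> set_W j" using assms(3) by (auto simp: mem_set_X)
  then have "0 \<le> weight \<epsilon> h x \<and> weight \<epsilon> h x \<le> 1"
  proof cases
    case 1 then show ?thesis by (simp add: weight_A)
  next
    case (2 j)
    show ?thesis using weight_W[of x j \<epsilon> h, OF 2 assms(1,2)] assms(1)[of j] by linarith
  qed
  then show "0 \<le> weight \<epsilon> h x" "weight \<epsilon> h x \<le> 1" by auto
qed

lemma weight_profile_le_3:
  assumes "x \<in> set_W j" "0 < \<epsilon> j" "\<epsilon> j \<le> 1" "0 < \<alpha>" "\<alpha> < 1" "1 / 3 \<le> fst x - 10 * real j"
  shows "weight \<epsilon> (profile \<alpha>) x \<le> 3 * \<epsilon> j"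
proof -
  have "fst x - 10 * real j \<le> 1"
    using assms(1) by (auto simp: set_W_def mem_set_U mem_set_V)
  then have "max (profile \<alpha> (fst x - 10 * real j)) 1 \<le> 3"
    using profile_le_3[OF assms(4-6)] by simp
  then have "\<epsilon> j * max (profile \<alpha> (fst x - 10 * real j)) 1 \<le> \<epsilon> j * 3"
    using assms(2) by (intro mult_left_mono) auto
  then show ?thesis
    using weight_W(2)[of x j \<epsilon> "profile \<alpha>", OF assms(1-3)] by linarith
qed

text \<open>Comparability with factor 9 survives both the maximum with 1 and the cap at 1, because
  the factor is at least 1. The constant is therefore uniform in
  \<open>\<epsilon> j\<close>.\<close>

lemma weight_profile_compare:
  assumes \<epsilon>: "0 < \<epsilon> j" and \<alpha>: "0 < \<alpha>" "\<alpha> < 1"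
    and st: "0 < s" "s < 1" "0 < t" "t < 1" "s \<le> 3 * t" "t \<le> 3 * s"
  shows "weight \<epsilon> (profile \<alpha>) (10 * real j + t, t / 2) \<le>
    9 * weight \<epsilon> (profile \<alpha>) (10 * real j + s, s / 2)"
proof -
  have "max (profile \<alpha> t) 1 \<le> 9 * max (profile \<alpha> s) 1"
    using profile_compare[of \<alpha> s t] \<alpha> st by auto
  then have "\<epsilon> j * max (profile \<alpha> t) 1 \<le> \<epsilon> j * (9 * max (profile \<alpha> s) 1)"
    using \<epsilon> by (intro mult_left_mono) auto
  then show ?thesis
    using st by (simp add: weight_U)
qed

text \<open>The push-forward of Lebesgue measure on (0, 1] under the parametrisation is
  \<open>mu\<close> restricted to \<open>set_U j\<close>. There is no Jacobian factor, since the
  velocity (1, 1/2) has maximum norm 1.\<close>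

lemma nn_integral_mu_U:
  assumes f: "f \<in> borel_measurable mu"
  shows "(\<integral>\<^sup>+x\<in>set_U j. f x \<partial>mu) = (\<integral>\<^sup>+u\<in>{0<..1}. f (10 * real j + u, u / 2) \<partial>lborel)"
proof -
  let ?\<phi> = "\<lambda>u. (10 * real j + u, u / 2)"
  let ?R = "restrict_space lborel {0<..1::real}"
  have "?\<phi> \<in> borel_measurable borel"
    by (intro borel_measurable_continuous_onI continuous_intros) auto
  then have "?\<phi> \<in> borel_measurable ?R"
    by (intro measurable_restrict_space1) simp
  then have "?\<phi> \<in> measurable ?R (restrict_space borel set_X)"
    by (intro measurable_restrict_space2) (auto simp: space_restrict_space U_point_in_X)
  then have \<phi>: "?\<phi> \<in> measurable ?R mu"
    by (simp cong: measurable_cong_sets add: sets_mu)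
  have "distr ?R mu ?\<phi> = density mu (indicator (set_U j))"
  proof (rule measure_eqI)
    fix E assume "E \<in> sets (distr ?R mu ?\<phi>)"
    then have E: "E \<in> sets mu" by simp
    then have UE: "set_U j \<inter> E \<in> sets mu" using set_U_mu by blast
    have iff: "?\<phi> u \<in> set_U k \<longleftrightarrow> k = j" if "0 < u" "u \<le> 1" for u k
    proof -
      have "k = j" if "?\<phi> u \<in> set_U k"
        using that \<open>0 < u\<close> \<open>u \<le> 1\<close> by (auto simp: mem_set_U)
      then show ?thesis using that by (auto simp: mem_set_U)
    qed
    have A: "{u. (u, 0) \<in> set_U j \<inter> E} = {}"
      by (auto simp: mem_set_U)
    have U: "emeasure lborel {u\<in>{0<..1}. (10 * real k + u, u / 2) \<in> set_U j \<inter> E} =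
        (if k = j then emeasure lborel {u\<in>{0<..1}. ?\<phi> u \<in> E} else 0)" for k
    proof (cases "k = j")
      case True
      then have "{u\<in>{0<..1}. (10 * real k + u, u / 2) \<in> set_U j \<inter> E} = {u\<in>{0<..1}. ?\<phi> u \<in> E}"
        using iff by auto
      then show ?thesis using True by simp
    next
      case False
      have "(10 * real k + u, u / 2) \<notin> set_U j" if "0 < u" "u \<le> 1" for u
        using that False by (auto simp: mem_set_U)
      then have "{u\<in>{0<..1}. (10 * real k + u, u / 2) \<in> set_U j \<inter> E} = {}" by auto
      then show ?thesis using False by (simp only: emeasure_empty) simp
    qed
    \<comment> \<open>A vertical segment meets \<open>set_U j\<close> at most in the corner of
      height 1/2, which is null.\<close>
    have V: "emeasure lborel {v\<in>{1/2..1}. (10 * real k + 1, v) \<in> set_U j \<inter> E} = 0" for k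
    proof -
      have "v = 1 / 2" if "(10 * real k + 1, v) \<in> set_U j" for v
      proof -
        have "real k < real j + 1" "real j < real k + 1" using that by (auto simp: mem_set_U)
        then have "k = j" by linarith
        then show ?thesis using that by (simp add: mem_set_U)
      qed
      then have "{v\<in>{1/2..1}. (10 * real k + 1, v) \<in> set_U j \<inter> E} \<subseteq> {1/2}" by auto
      then have "emeasure lborel {v\<in>{1/2..1}. (10 * real k + 1, v) \<in> set_U j \<inter> E} \<le> emeasure lborel {1/2::real}"
        by (rule emeasure_mono) auto
      then show ?thesis
        unfolding emeasure_lborel_singleton by simp
    qed
    have "emeasure (density mu (indicator (set_U j))) E = emeasure mu (set_U j \<inter> E)"
      using E set_U_mu by (simp add: emeasure_density nn_integral_indicator flip: indicator_inter_arith)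
    also have "\<dots> = (\<Sum>k. if k = j then emeasure lborel {u\<in>{0<..1}. ?\<phi> u \<in> E} else 0)"
      unfolding emeasure_mu_explicit[OF UE] A U V by simp
    also have "\<dots> = emeasure lborel {u\<in>{0<..1}. ?\<phi> u \<in> E}"
      by (subst suminf_finite[of "{j}"]) auto
    also have "{u\<in>{0<..1}. ?\<phi> u \<in> E} = ?\<phi> -` E \<inter> space ?R"
      by (auto simp: space_restrict_space)
    also have "emeasure lborel \<dots> = emeasure ?R \<dots>"
      by (subst emeasure_restrict_space) (auto simp: space_restrict_space)
    finally show "emeasure (distr ?R mu ?\<phi>) E = emeasure (density mu (indicator (set_U j))) E"
      using E by (simp add: emeasure_distr[OF \<phi>])
  qed simp
  then have "(\<integral>\<^sup>+x. f x \<partial>density mu (indicator (set_U j))) = (\<integral>\<^sup>+x. f x \<partial>distr ?R mu ?\<phi>)"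
    by simp
  then show ?thesis
    using f set_U_mu \<phi>
    by (simp add: nn_integral_density nn_integral_distr nn_integral_restrict_space mult.commute)
qed

text \<open>A ball whose radius is at most the height of its centre misses the axis, balls being
  open. That radius is at most 1, whereas different branches are at horizontal distance at least
  9.\<close>

lemma qball_subset_W:
  assumes "x \<in> set_W j" "r \<le> snd x"
  shows "qball set_X linf x r \<subseteq> set_W j"
proof
  fix y assume y: "y \<in> qball set_X linf x r"
  have "r \<le> 1" using assms by (auto simp: set_W_def mem_set_U mem_set_V)
  have "y \<notin> set_A" using y assms(2) by (auto simp: mem_qball_X mem_set_A)
  then obtain k where k: "y \<in> set_W k" using y by (auto simp: mem_qball_X mem_set_X)
  have "10 * real j \<le> fst x" "fst x \<le> 10 * real j + 1" "10 * real k \<le> fst y" "fst y \<le> 10 * real k + 1"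
    using k assms by (auto simp: set_W_def mem_set_U mem_set_V)
  then have "real j < real k + 1" "real k < real j + 1"
    using y \<open>r \<le> 1\<close> by (auto simp: mem_qball_X)
  then have "k = j" by linarith
  then show "y \<in> set_W j" using k by simp
qed

text \<open>Together with \<open>qball_subset_W\<close> this shows that each branch is itself a
  ball, of radius 1 around its top point. The strict inequality holds because \<open>set_U j\<close>
  omits its end point on the axis.\<close>

lemma W_subset_qball: "set_W j \<subseteq> qball set_X linf (10 * real j + 1, 1) 1"
proof
  fix x assume x: "x \<in> set_W j"
  then have "x \<in> set_X" by (auto simp: mem_set_X)
  then show "x \<in> qball set_X linf (10 * real j + 1, 1) 1"
    using x by (auto simp: mem_qball_X set_W_def mem_set_U mem_set_V)
qed

text \<open>The true length is 1/2; any bound uniform in \<open>j\<close> is enough below.\<close>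

lemma emeasure_V_le: "emeasure mu (set_V j) \<le> 6"
proof -
  have "emeasure mu (set_V j) \<le> emeasure mu (qball set_X linf (10 * real j + 1, 1) 1)"
    using W_subset_qball[of j] by (intro emeasure_mono qball_mu) (auto simp: set_W_def)
  also have "\<dots> \<le> 6"
    using emeasure_qball_le[of 1] by simp
  finally show ?thesis .
qed

text \<open>Dropping the cap at 1 makes the estimate homogeneous in \<open>\<epsilon> j\<close>:
  apart from the factor \<open>\<epsilon> j powr q\<close> nothing on the right depends on
  \<open>j\<close>. It is applied with the exponent of the class and, for the negative result, with
  exponent 1.\<close>

lemma nn_integral_weight_W_le:
  assumes \<epsilon>: "0 < \<epsilon> j" "\<epsilon> j \<le> 1" and \<alpha>: "0 < \<alpha>" and q: "q > 0" and B: "B \<subseteq> set_W j"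
  shows "(\<integral>\<^sup>+y\<in>B. ennreal (weight \<epsilon> (profile \<alpha>) y powr q) \<partial>mu) \<le>
    ennreal (\<epsilon> j powr q) * ((\<integral>\<^sup>+t\<in>{0<..1}. ennreal (max (profile \<alpha> t) 1 powr q) \<partial>lborel) + 6)"
proof -
  let ?w = "weight \<epsilon> (profile \<alpha>)"
  note [measurable] = weight_measurable[OF profile_measurable, of \<epsilon> \<alpha>] set_U_mu set_V_mu
  have "(\<integral>\<^sup>+y\<in>B. ennreal (?w y powr q) \<partial>mu) \<le>
    (\<integral>\<^sup>+y. ennreal (?w y powr q) * indicator (set_U j) y + ennreal (\<epsilon> j powr q) * indicator (set_V j) y \<partial>mu)"
    using B by (intro nn_integral_mono) (auto simp: set_W_def weight_V split: split_indicator)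
  also have "\<dots> = (\<integral>\<^sup>+y\<in>set_U j. ennreal (?w y powr q) \<partial>mu) + ennreal (\<epsilon> j powr q) * emeasure mu (set_V j)"
    by (subst nn_integral_add) (auto simp: nn_integral_cmult_indicator set_V_mu)
  also have "(\<integral>\<^sup>+y\<in>set_U j. ennreal (?w y powr q) \<partial>mu) =
      (\<integral>\<^sup>+u\<in>{0<..1}. ennreal (?w (10 * real j + u, u / 2) powr q) \<partial>lborel)"
    by (rule nn_integral_mu_U; measurable)
  also have "\<dots> \<le> (\<integral>\<^sup>+u. ennreal (\<epsilon> j powr q) * (ennreal (max (profile \<alpha> u) 1 powr q) * indicator {0<..1} u) \<partial>lborel)"
  proof (rule nn_integral_mono)
    fix u :: real
    show "ennreal (?w (10 * real j + u, u / 2) powr q) * indicator {0<..1} u \<le>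
      ennreal (\<epsilon> j powr q) * (ennreal (max (profile \<alpha> u) 1 powr q) * indicator {0<..1} u)"
    proof (cases "0 < u \<and> u \<le> 1")
      case True
      then have W: "(10 * real j + u, u / 2) \<in> set_W j" by (auto simp: set_W_def mem_set_U)
      have "?w (10 * real j + u, u / 2) powr q \<le> (\<epsilon> j * max (profile \<alpha> u) 1) powr q"
        using weight_W[of _ j \<epsilon> "profile \<alpha>", OF W \<epsilon>] q \<epsilon> by (intro powr_mono2) auto
      also have "\<dots> = \<epsilon> j powr q * max (profile \<alpha> u) 1 powr q"
        using \<epsilon> by (intro powr_mult)
      finally show ?thesis using True by (simp add: ennreal_mult[symmetric] ennreal_leI)
    qed auto
  qed
  also have "\<dots> = ennreal (\<epsilon> j powr q) * (\<integral>\<^sup>+t\<in>{0<..1}. ennreal (max (profile \<alpha> t) 1 powr q) \<partial>lborel)"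
    by (rule nn_integral_cmult; measurable)
  finally show ?thesis
    using emeasure_V_le[of j] by (auto simp: distrib_left elim!: order_trans intro!: add_mono mult_left_mono)
qed

section \<open>Membership in the reverse Hoelder classes\<close>

text \<open>The constant is 3 for balls meeting the axis and for balls away from the singularity, 81
  for low balls on the slanted piece, and the last value for large balls centred on the vertical
  piece. A finite list independent of \<open>x\<close>, \<open>r\<close> and \<open>j\<close> leaves
  only a maximum to be taken.\<close>

lemma weight_profile_reverse_Hoelder_ball:
  assumes \<epsilon>: "\<And>j. 0 < \<epsilon> j" "\<And>j. \<epsilon> j \<le> 1" and \<alpha>: "0 < \<alpha>" "\<alpha> < 1"
    and q: "q > 1"
    and I: "(\<integral>\<^sup>+t\<in>{0<..1}. ennreal (max (profile \<alpha> t) 1 powr q) \<partial>lborel) \<le> ennreal I" "I \<ge> 0"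
    and x: "x \<in> set_X" and r: "r > 0"
  shows "\<exists>C\<in>{3, 81, (12 * (I + 6)) powr (1 / q)}.
    ennreal_powr (average mu (qball set_X linf x r) (\<lambda>y. weight \<epsilon> (profile \<alpha>) y powr q)) (1 / q)
      \<le> ennreal C * average mu (qball set_X linf x r) (weight \<epsilon> (profile \<alpha>))"
proof -
  let ?w = "weight \<epsilon> (profile \<alpha>)" and ?B = "qball set_X linf x r"
  define K where "K = (12 * (I + 6)) powr (1 / q)"
  have q0: "q > 0" using q by simp
  have w: "?w \<in> borel_measurable mu"
    by (rule weight_measurable[OF profile_measurable])
  have Bge: "ennreal (r / 6) \<le> emeasure mu ?B"
    by (rule emeasure_qball_ge[OF x r])
  have B0: "emeasure mu ?B \<noteq> 0"
  proof
    assume "emeasure mu ?B = 0"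
    then show False using Bge r by (simp add: ennreal_eq_0_iff)
  qed
  have Bfin: "emeasure mu ?B < \<infinity>"
    using le_less_trans[OF emeasure_qball_le[OF r] ennreal_less_top] by simp
  note comparable = reverse_Hoelder_ball_comparable[OF q0 _ _ qball_mu B0 Bfin w]
  \<comment> \<open>The cases are exhaustive. Suppose the ball misses the axis and reaches
    parameters below 1/3. A centre with parameter \<open>u\<close> on the slanted piece has
    \<open>r \<le> u / 2\<close>, so \<open>u / 2 \<le> u - r < 1 / 3\<close>, which is case
    \<open>U\<close>. A centre on the vertical piece has \<open>r > 2 / 3\<close>, which is case
    \<open>V\<close>.\<close>
  consider (A) "\<bar>snd x\<bar> < r"
    | (U) j where "x \<in> set_U j" "r \<le> snd x" "snd x \<le> 1 / 3"
    | (near_V) j where "x \<in> set_W j" "r \<le> snd x" "fst x - 10 * real j - r \<ge> 1 / 3"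
    | (V) j where "x \<in> set_V j" "r \<le> snd x" "r > 1 / 2"
  proof (cases "\<bar>snd x\<bar> < r")
    case True
    then show ?thesis by (rule A)
  next
    case F: False
    have "x \<notin> set_A" using F r by (auto simp: mem_set_A)
    then obtain j where j: "x \<in> set_W j"
      using x by (auto simp: mem_set_X)
    have sx: "r \<le> snd x" using F j by (auto simp: set_W_def mem_set_U mem_set_V)
    show ?thesis
    proof (cases "fst x - 10 * real j - r \<ge> 1 / 3")
      case True
      then show ?thesis using near_V j sx by blast
    next
      case False
      consider "x \<in> set_U j" "x \<notin> set_V j" | "x \<in> set_V j" using j by (auto simp: set_W_def)
      then show ?thesis
      proof cases
        case 1
        then have "snd x \<le> 1 / 3" using sx False by (auto simp: mem_set_U)
        then show ?thesis using U 1 sx by blast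
      next
        case 2
        then have "r > 1 / 2" using False by (auto simp: mem_set_V)
        then show ?thesis using V 2 sx by blast
      qed
    qed
  qed
  then show ?thesis
  proof cases
    case A
    have "ennreal_powr (average mu ?B (\<lambda>y. ?w y powr q)) (1 / q) \<le> ennreal 3 * average mu ?B ?w"
    \<comment> \<open>The weight is at most 1 everywhere and equals 1 on the axis part, whose length
      \<open>2 * r\<close> is at least a third of the measure of the ball.\<close>
    proof (rule reverse_Hoelder_ballI[where a = 1, OF q0 _ B0 Bfin])
      have "(\<integral>\<^sup>+y\<in>?B. ennreal (?w y powr q) \<partial>mu) \<le> (\<integral>\<^sup>+y. indicator ?B y \<partial>mu)"
      proof (rule nn_integral_mono)
        fix y
        have "?w y powr q \<le> 1 powr q" if "y \<in> set_X"
          using weight_bounds[of \<epsilon> y "profile \<alpha>"] \<epsilon> that q by (intro powr_mono2) auto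
        then show "ennreal (?w y powr q) * indicator ?B y \<le> indicator ?B y"
          by (auto simp: mem_qball_X split: split_indicator)
      qed
      then show "(\<integral>\<^sup>+y\<in>?B. ennreal (?w y powr q) \<partial>mu) \<le> ennreal (1 powr q) * emeasure mu ?B"
        using qball_mu by simp
      have "ennreal 1 * emeasure mu ?B \<le> ennreal (6 * r)"
        using emeasure_qball_le[OF r] by simp
      also have "\<dots> = ennreal 3 * ennreal (2 * r)"
        using r by (subst ennreal_mult[symmetric]) auto
      also have "\<dots> \<le> ennreal 3 * emeasure mu (set_A \<inter> ?B)"
        using qball_near_A[OF A] by (rule mult_left_mono) simp
      also have "emeasure mu (set_A \<inter> ?B) = (\<integral>\<^sup>+y. indicator (set_A \<inter> ?B) y \<partial>mu)"
        using set_A_mu qball_mu by simp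
      also have "\<dots> \<le> (\<integral>\<^sup>+y\<in>?B. ennreal (?w y) \<partial>mu)"
        by (intro nn_integral_mono) (auto simp: weight_A split: split_indicator)
      finally show "ennreal 1 * emeasure mu ?B \<le> ennreal 3 * (\<integral>\<^sup>+y\<in>?B. ennreal (?w y) \<partial>mu)"
        by (simp add: mult_left_mono)
    qed simp
    then show ?thesis by blast
  next
    case (U j)
    define u where "u = fst x - 10 * real j"
    have u: "x = (10 * real j + u, u / 2)" "0 < u" "u \<le> 2 / 3" "r \<le> u / 2"
      using U by (auto simp: u_def mem_set_U prod_eq_iff)
    have wx: "0 \<le> ?w x" using weight_bounds[of \<epsilon> x] \<epsilon> x by blast
    have "ennreal_powr (average mu ?B (\<lambda>y. ?w y powr q)) (1 / q) \<le> ennreal 81 * average mu ?B ?w"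
    \<comment> \<open>From \<open>r \<le> u / 2\<close> a parameter \<open>t\<close> in the ball
      satisfies \<open>u / 2 < t < 3 * u / 2\<close>, and \<open>u \<le> 2 / 3\<close> keeps it
      below 1. So the weight varies between 1/9 and 9 times its value at the centre, whence
      81.\<close>
    proof (rule comparable[of "?w x / 9"])
      fix y assume y: "y \<in> ?B"
      define t where "t = fst y - 10 * real j"
      have "y \<in> set_W j"
        using qball_subset_W[of x j r] U y by (auto simp: set_W_def)
      moreover have ty: "\<bar>u - t\<bar> < r" using y by (simp add: mem_qball_X u_def t_def)
      ultimately have t: "y = (10 * real j + t, t / 2)" "0 < t" "t < 1"
        using u by (auto simp: t_def set_W_def mem_set_U mem_set_V prod_eq_iff)
      have ut: "t \<le> 3 * u" "u \<le> 3 * t" using ty u by auto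
      have 1: "?w x \<le> 9 * ?w y" "?w y \<le> 9 * ?w x"
        unfolding t(1) u(1)
        by (rule weight_profile_compare; use \<epsilon> \<alpha> t u ut in simp)+
      then show "?w x / 9 \<le> ?w y \<and> ?w y \<le> 81 * (?w x / 9)"
        by simp
    qed (use wx in auto)
    then show ?thesis by blast
  next
    case (near_V j)
    have "ennreal_powr (average mu ?B (\<lambda>y. ?w y powr q)) (1 / q) \<le> ennreal 3 * average mu ?B ?w"
    proof (rule comparable[of "\<epsilon> j"])
      fix y assume y: "y \<in> ?B"
      have W: "y \<in> set_W j"
        using qball_subset_W[of x j r] near_V y by auto
      have "1 / 3 \<le> fst y - 10 * real j"
        using y near_V by (auto simp: mem_qball_X)
      then show "\<epsilon> j \<le> ?w y \<and> ?w y \<le> 3 * \<epsilon> j"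
        using weight_W(1)[of y j \<epsilon>, OF W \<epsilon>] weight_profile_le_3[of y j \<epsilon>, OF W \<epsilon> \<alpha>] by blast
    qed (use less_imp_le[OF \<epsilon>(1)] in auto)
    then show ?thesis by blast
  next
    case (V j)
    have BW: "?B \<subseteq> set_W j"
      using qball_subset_W[of x j r] V by (auto simp: set_W_def)
    have K: "K \<ge> 0" "K powr q = 12 * (I + 6)"
      using I q by (auto simp: K_def powr_powr)
    have "ennreal_powr (average mu ?B (\<lambda>y. ?w y powr q)) (1 / q) \<le> ennreal K * average mu ?B ?w"
    \<comment> \<open>Both the power mean and the mean scale with \<open>\<epsilon> j\<close>, so it
      cancels. The mean is at least \<open>\<epsilon> j\<close>; in \<open>K\<close> the factor 12
      compensates the lower bound 1/12 for the measure of a ball with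
      \<open>r > 1 / 2\<close>.\<close>
    proof (rule reverse_Hoelder_ballI[where a = "\<epsilon> j * K", OF q0 _ B0 Bfin])
      show "0 \<le> \<epsilon> j * K" using K \<epsilon>(1)[of j] by simp
      have "(\<integral>\<^sup>+y\<in>?B. ennreal (?w y powr q) \<partial>mu) \<le> ennreal (\<epsilon> j powr q) *
          ((\<integral>\<^sup>+t\<in>{0<..1}. ennreal (max (profile \<alpha> t) 1 powr q) \<partial>lborel) + 6)"
        by (rule nn_integral_weight_W_le[of \<epsilon>, OF \<epsilon> \<alpha>(1) q0 BW])
      also have "\<dots> \<le> ennreal (\<epsilon> j powr q) * (ennreal I + ennreal 6)"
        by (intro mult_left_mono add_mono I) auto
      also have "\<dots> = ennreal (\<epsilon> j powr q) * ennreal (12 * (I + 6) * (1 / 12))"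
      proof -
        have "12 * (I + 6) * (1 / 12) = I + 6" by simp
        then show ?thesis using I(2) by (simp only: ennreal_plus)
      qed
      also have "\<dots> = ennreal (\<epsilon> j powr q) * (ennreal (12 * (I + 6)) * ennreal (1 / 12))"
        using I by (subst ennreal_mult) auto
      also have "\<dots> \<le> ennreal (\<epsilon> j powr q) * (ennreal (12 * (I + 6)) * emeasure mu ?B)"
      proof (intro mult_left_mono)
        have "ennreal (1 / 12) \<le> ennreal (r / 6)"
          using V by (intro ennreal_leI) auto
        then show "ennreal (1 / 12) \<le> emeasure mu ?B" using Bge by (rule order_trans)
      qed auto
      also have "\<dots> = ennreal ((\<epsilon> j * K) powr q) * emeasure mu ?B"
        using K \<epsilon>(1)[of j] I by (simp add: powr_mult ennreal_mult mult.assoc)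
      finally show "(\<integral>\<^sup>+y\<in>?B. ennreal (?w y powr q) \<partial>mu) \<le> ennreal ((\<epsilon> j * K) powr q) * emeasure mu ?B" .
      have "ennreal (\<epsilon> j * K) * emeasure mu ?B = ennreal K * (\<integral>\<^sup>+y\<in>?B. ennreal (\<epsilon> j) \<partial>mu)"
        using qball_mu[of x r] K \<epsilon>(1)[of j]
        by (subst nn_integral_cmult_indicator) (auto simp: ennreal_mult mult_ac)
      also have "\<dots> \<le> ennreal K * (\<integral>\<^sup>+y\<in>?B. ennreal (?w y) \<partial>mu)"
        using BW weight_W(1)[of _ j \<epsilon>, OF _ \<epsilon>]
        by (intro mult_left_mono nn_integral_mono) (auto split: split_indicator intro!: ennreal_leI)
      finally show "ennreal (\<epsilon> j * K) * emeasure mu ?B \<le> ennreal K * (\<integral>\<^sup>+y\<in>?B. ennreal (?w y) \<partial>mu)" .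
    qed
    then show ?thesis by (auto simp: K_def)
  qed
qed

lemma weight_profile_in_RH:
  assumes \<epsilon>: "\<And>j. 0 < \<epsilon> j" "\<And>j. \<epsilon> j \<le> 1" and \<alpha>: "0 < \<alpha>" "\<alpha> < 1"
    and q: "q > 1" "\<alpha> * q \<le> 1"
  shows "weight \<epsilon> (profile \<alpha>) \<in> RH set_X linf mu q"
proof -
  let ?w = "weight \<epsilon> (profile \<alpha>)"
  obtain I where I: "I \<ge> 0"
    "(\<integral>\<^sup>+t\<in>{0<..1}. ennreal (max (profile \<alpha> t) 1 powr q) \<partial>lborel) = ennreal I"
    using nn_integral_profile_powr[OF \<alpha>(1) q] by (auto simp: less_top_ennreal)
  define C where "C = max 81 ((12 * (I + 6)) powr (1 / q))"
  have "ennreal_powr (average mu (qball set_X linf x r) (\<lambda>y. ?w y powr q)) (1 / q)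
      \<le> ennreal C * average mu (qball set_X linf x r) ?w" if x: "x \<in> set_X" "r > 0" for x r
  proof -
    obtain c where c: "c \<in> {3, 81, (12 * (I + 6)) powr (1 / q)}"
      "ennreal_powr (average mu (qball set_X linf x r) (\<lambda>y. ?w y powr q)) (1 / q)
        \<le> ennreal c * average mu (qball set_X linf x r) ?w"
      using weight_profile_reverse_Hoelder_ball[of \<epsilon>, OF \<epsilon> \<alpha> q(1) eq_refl[OF I(2)] I(1) x] by blast
    then have "c \<le> C" by (auto simp: C_def)
    then show ?thesis
      using c(2) by (meson ennreal_leI mult_right_mono order_trans zero_le)
  qed
  then show ?thesis
    unfolding RH_def using weight_bounds(1)[of \<epsilon>, OF \<epsilon>] weight_measurable[OF profile_measurable]
    by blast
qed

text \<open>The branches themselves serve as test balls. Since the profile is integrable, the mean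
  of the weight over the branch is \<open>O(\<epsilon> j)\<close>, so a reverse Hoelder inequality
  would bound the integral of its \<open>p\<close>-th power by a constant times
  \<open>\<epsilon> j powr p\<close>. But this integral is at least
  \<open>\<epsilon> j powr p\<close> times \<open>ln (t0 / 2) - p * ln (\<epsilon> j)\<close>, and
  the last factor is unbounded.\<close>

lemma weight_profile_not_in_RH:
  assumes \<epsilon>: "\<And>j. 0 < \<epsilon> j" "\<And>j. \<epsilon> j \<le> 1" "\<epsilon> \<longlonglongrightarrow> 0" and \<alpha>: "0 < \<alpha>" "\<alpha> < 1"
    and p: "\<alpha> * p > 1"
  shows "weight \<epsilon> (profile \<alpha>) \<notin> RH set_X linf mu p"
proof
  let ?w = "weight \<epsilon> (profile \<alpha>)"
  let ?B = "\<lambda>j. qball set_X linf (10 * real j + 1, 1) 1"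
  assume "?w \<in> RH set_X linf mu p"
  then obtain C where C: "\<And>x r. x \<in> set_X \<Longrightarrow> r > 0 \<Longrightarrow>
     ennreal_powr (average mu (qball set_X linf x r) (\<lambda>y. ?w y powr p)) (1 / p)
          \<le> ennreal C * average mu (qball set_X linf x r) ?w"
    by (auto simp: RH_def)
  have p0: "p > 0" using p \<alpha> by (metis less_trans zero_less_mult_pos zero_less_one)
  note [measurable] = weight_measurable[OF profile_measurable, of \<epsilon> \<alpha>]
  obtain I where I: "I \<ge> 0"
    "(\<integral>\<^sup>+t\<in>{0<..1}. ennreal (max (profile \<alpha> t) 1 powr 1) \<partial>lborel) \<le> ennreal I"
  proof -
    \<comment> \<open>The base is at least 1, so integrability at the admissible exponent
      \<open>1 / \<alpha> > 1\<close> implies integrability at exponent 1.\<close>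
    have "(\<integral>\<^sup>+t\<in>{0<..1}. ennreal (max (profile \<alpha> t) 1 powr 1) \<partial>lborel) \<le>
      (\<integral>\<^sup>+t\<in>{0<..1}. ennreal (max (profile \<alpha> t) 1 powr (1 / \<alpha>)) \<partial>lborel)"
      using \<alpha> by (intro nn_integral_mono mult_right_mono ennreal_leI powr_mono) auto
    also have "\<dots> < \<infinity>"
      using \<alpha> by (intro nn_integral_profile_powr) auto
    finally have "(\<integral>\<^sup>+t\<in>{0<..1}. ennreal (max (profile \<alpha> t) 1 powr 1) \<partial>lborel) < top" by simp
    then obtain I where "I \<ge> 0"
      "(\<integral>\<^sup>+t\<in>{0<..1}. ennreal (max (profile \<alpha> t) 1 powr 1) \<partial>lborel) = ennreal I"
      unfolding less_top_ennreal by blast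
    then show ?thesis using that eq_refl by blast
  qed
  obtain t0 where t0: "0 < t0" "t0 < 1" "\<And>t. 0 < t \<Longrightarrow> t < t0 \<Longrightarrow> 1 / t \<le> profile \<alpha> t powr p"
    using profile_powr_large[OF \<alpha>(1) p] by blast
  \<comment> \<open>The constant \<open>C\<close> may be negative, in which case
    \<open>ennreal C\<close> is 0; hence the maximum. The factor 6 compensates the lower bound 1/6
    for the measure of the test ball.\<close>
  define D where "D = max C 0 * (6 * (I + 6))"
  have D: "D \<ge> 0" using I by (simp add: D_def)
  have bound: "ln (t0 / 2) - p * ln (\<epsilon> j) \<le> D powr p * 6" if small: "\<epsilon> j powr p \<le> t0 / 2" for j
  proof -
    let ?x = "(10 * real j + 1, 1)"
    have BW: "?B j \<subseteq> set_W j"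
      by (rule qball_subset_W) (auto simp: set_W_def mem_set_V)
    have xX: "?x \<in> set_X" by (rule V_point_in_X) auto
    have Bge: "ennreal (1 / 6) \<le> emeasure mu (?B j)"
      using emeasure_qball_ge[OF xX, of 1] by simp
    have Ble: "emeasure mu (?B j) \<le> ennreal 6"
      using emeasure_qball_le[of 1 ?x] by simp
    have "(\<integral>\<^sup>+y\<in>?B j. ennreal (?w y) \<partial>mu) = (\<integral>\<^sup>+y\<in>?B j. ennreal (?w y powr 1) \<partial>mu)"
      using weight_bounds(1)[of \<epsilon>, OF \<epsilon>(1,2)]
      by (intro nn_integral_cong) (auto simp: mem_qball_X split: split_indicator)
    also have "\<dots> \<le> ennreal (\<epsilon> j powr 1) *
        ((\<integral>\<^sup>+t\<in>{0<..1}. ennreal (max (profile \<alpha> t) 1 powr 1) \<partial>lborel) + 6)"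
      by (rule nn_integral_weight_W_le[of \<epsilon>, OF \<epsilon>(1,2) \<alpha>(1) zero_less_one BW])
    also have "\<dots> \<le> ennreal (\<epsilon> j powr 1) * (ennreal I + ennreal 6)"
      by (intro mult_left_mono add_mono I) auto
    also have "\<dots> = ennreal (\<epsilon> j * (I + 6))"
      using I \<epsilon>(1)[of j] by (simp add: ennreal_mult)
    also have "\<dots> = ennreal (\<epsilon> j * (6 * (I + 6))) * ennreal (1 / 6)"
      using I \<epsilon>(1)[of j] by (subst ennreal_mult[symmetric]) auto
    also have "\<dots> \<le> ennreal (\<epsilon> j * (6 * (I + 6))) * emeasure mu (?B j)"
      by (intro mult_left_mono Bge) auto
    finally have "average mu (?B j) ?w \<le> ennreal (\<epsilon> j * (6 * (I + 6))) * emeasure mu (?B j) / emeasure mu (?B j)"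
      unfolding average_def by (rule divide_right_mono_ennreal)
    also have "\<dots> = ennreal (\<epsilon> j * (6 * (I + 6)))"
      using Bge Ble by (intro mult_divide_eq_ennreal) (auto simp: top_unique)
    finally have "ennreal C * average mu (?B j) ?w \<le> ennreal (max C 0) * ennreal (\<epsilon> j * (6 * (I + 6)))"
      by (intro mult_mono ennreal_leI) auto
    also have "\<dots> = ennreal (\<epsilon> j * D)"
      using I \<epsilon>(1)[of j] by (subst ennreal_mult[symmetric]) (auto simp: D_def mult_ac)
    finally have "ennreal_powr (average mu (?B j) (\<lambda>y. ?w y powr p)) (1 / p) \<le> ennreal (\<epsilon> j * D)"
      using C[OF xX, of 1] by (auto intro: order_trans)
    then have avg: "average mu (?B j) (\<lambda>y. ?w y powr p) \<le> ennreal ((\<epsilon> j * D) powr p)"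
      using p0 D \<epsilon>(1)[of j] by (subst (asm) ennreal_powr_le_iff) auto
    have "(\<integral>\<^sup>+y\<in>?B j. ennreal (?w y powr p) \<partial>mu) = average mu (?B j) (\<lambda>y. ?w y powr p) * emeasure mu (?B j)"
      unfolding average_def using Bge Ble
      by (subst ennreal_divide_times, subst ennreal_divide_self) (use le_less_trans[OF Ble ennreal_less_top] in auto)
    also have "\<dots> \<le> ennreal ((\<epsilon> j * D) powr p) * ennreal 6"
      by (intro mult_mono avg Ble) auto
    also have "\<dots> = ennreal (\<epsilon> j powr p) * ennreal (D powr p * 6)"
      using D \<epsilon>(1)[of j] by (subst (1 2) ennreal_mult[symmetric]) (auto simp: powr_mult mult_ac)
    finally have upper: "(\<integral>\<^sup>+y\<in>?B j. ennreal (?w y powr p) \<partial>mu) \<le> ennreal (\<epsilon> j powr p) * ennreal (D powr p * 6)" .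
    \<comment> \<open>The lower cut-off \<open>a\<close> is chosen so that \<open>a / t\<close> is
      at most 1 for \<open>t \<ge> a\<close>: where the weight is capped at 1 it still dominates.
      Elsewhere \<open>1 / t \<le> profile \<alpha> t powr p\<close> applies, and
      \<open>t0 / 2\<close> keeps the closed interval inside its range
      \<open>t < t0\<close>.\<close>
    define a where "a = \<epsilon> j powr p"
    have a: "0 < a" "a \<le> t0 / 2" using small \<epsilon>(1)[of j] by (auto simp: a_def)
    have "ennreal a * ennreal (ln (t0 / 2) - ln a) = ennreal a * (\<integral>\<^sup>+t. ennreal (1 / t) * indicator {a..t0 / 2} t \<partial>lborel)"
      using a by (subst nn_integral_FTC_Icc[where F = ln]) (auto intro!: derivative_eq_intros)
    also have "\<dots> = (\<integral>\<^sup>+t. ennreal a * (ennreal (1 / t) * indicator {a..t0 / 2} t) \<partial>lborel)"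
      by (rule nn_integral_cmult[symmetric]) measurable
    also have "\<dots> \<le> (\<integral>\<^sup>+u\<in>{0<..1}. ennreal (?w (10 * real j + u, u / 2) powr p) \<partial>lborel)"
    proof (rule nn_integral_mono)
      fix t :: real
      show "ennreal a * (ennreal (1 / t) * indicator {a..t0 / 2} t) \<le>
          ennreal (?w (10 * real j + t, t / 2) powr p) * indicator {0<..1} t"
      proof (cases "a \<le> t \<and> t \<le> t0 / 2")
        case True
        then have t: "0 < t" "t < t0" "t < 1" using a t0 by auto
        have "a / t \<le> (min 1 (\<epsilon> j * max (profile \<alpha> t) 1)) powr p"
        proof (cases "1 \<le> \<epsilon> j * max (profile \<alpha> t) 1")
          case T: True
          then show ?thesis using True t by (simp add: min_absorb1)
        next
          case False
          have "a / t \<le> a * profile \<alpha> t powr p"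
            using t0(3)[OF t(1,2)] a mult_left_mono[of "1 / t" "profile \<alpha> t powr p" a] by simp
          also have "\<dots> \<le> a * max (profile \<alpha> t) 1 powr p"
          proof (intro mult_left_mono powr_mono2)
            show "0 \<le> profile \<alpha> t" unfolding profile_eq[OF t(1)] using t
              by (intro divide_nonneg_nonneg powr_ge_zero
                  order_trans[OF zero_le_one one_minus_ln_ge_1]) auto
          qed (use a p0 in auto)
          also have "\<dots> = (\<epsilon> j * max (profile \<alpha> t) 1) powr p"
            unfolding a_def by (rule powr_mult[symmetric])
          finally show ?thesis using False by (simp add: min_absorb2)
        qed
        then show ?thesis
          using True t a by (simp add: weight_U ennreal_mult[symmetric] ennreal_leI)
      qed auto
    qed
    also have "\<dots> = (\<integral>\<^sup>+y\<in>set_U j. ennreal (?w y powr p) \<partial>mu)"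
      by (rule nn_integral_mu_U[symmetric]; measurable)
    also have "\<dots> \<le> (\<integral>\<^sup>+y\<in>?B j. ennreal (?w y powr p) \<partial>mu)"
      using W_subset_qball[of j] by (intro nn_integral_mono) (auto simp: set_W_def split: split_indicator)
    also have "\<dots> \<le> ennreal a * ennreal (D powr p * 6)"
      unfolding a_def by (rule upper)
    finally have "ennreal (a * (ln (t0 / 2) - ln a)) \<le> ennreal (a * (D powr p * 6))"
      using a by (simp add: ennreal_mult)
    then have "ln (t0 / 2) - ln a \<le> D powr p * 6"
      using a by (subst (asm) ennreal_le_iff) auto
    then show ?thesis using \<epsilon>(1)[of j] by (simp add: a_def ln_powr)
  qed
  have lim: "filterlim \<epsilon> (at_right 0) sequentially"
    unfolding filterlim_at using \<epsilon>(3) \<epsilon>(1)[THEN less_imp_neq, symmetric] \<epsilon>(1) by simp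
  have "filterlim (\<lambda>x::real. ln (t0 / 2) - p * ln x) at_top (at_right 0)"
    using p0 by real_asymp
  then have "eventually (\<lambda>x::real. ln (t0 / 2) - p * ln x > D powr p * 6) (at_right 0)"
    by (simp add: filterlim_at_top_dense)
  then have "eventually (\<lambda>j. ln (t0 / 2) - p * ln (\<epsilon> j) > D powr p * 6) sequentially"
    by (rule eventually_compose_filterlim[OF _ lim])
  moreover have "((\<lambda>x::real. x powr p) \<longlongrightarrow> 0) (at_right 0)"
    using p0 by real_asymp
  then have "eventually (\<lambda>x::real. x powr p < t0 / 2) (at_right 0)"
    using t0(1) by (intro order_tendstoD) auto
  then have "eventually (\<lambda>j. \<epsilon> j powr p < t0 / 2) sequentially"
    by (rule eventually_compose_filterlim[OF _ lim])
  ultimately have "eventually (\<lambda>j. False) sequentially"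
  proof eventually_elim
    case (elim j)
    then show ?case using bound[of j] by (meson less_imp_le not_less)
  qed
  then show False by simp
qed

theorem mainTheorem4:
  fixes \<epsilon> :: "nat \<Rightarrow> real" and \<alpha> :: real
  assumes "\<And>j. 0 < \<epsilon> j" and "\<And>j. \<epsilon> j \<le> 1" and "\<epsilon> \<longlonglongrightarrow> 0"
    and "0 < \<alpha>" and "\<alpha> < 1"
  defines "h \<equiv> \<lambda>t::real. t powr (- \<alpha>) * inverse (ln (exp 1 / t))"
  shows "(Metric_space set_X linf \<and> homogeneous_type set_X linf mu \<and>
            Ahlfors_regular 1 set_X linf mu) \<and>
         (\<forall>p>1. weight \<epsilon> h \<in> RH set_X linf mu p \<longleftrightarrow> p \<le> 1 / \<alpha>) \<and>
         \<not> (\<forall>(M :: (real \<times> real) set) d \<mu>.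
              Metric_space M d \<and> homogeneous_type M d \<mu> \<longrightarrow> strong_self_improving M d \<mu>)"
proof -
  have h: "h = profile \<alpha>" by (simp add: h_def profile_def)
  have RH_iff: "weight \<epsilon> h \<in> RH set_X linf mu p \<longleftrightarrow> p \<le> 1 / \<alpha>" if "p > 1" for p
  proof (cases "p \<le> 1 / \<alpha>")
    case True
    then have "\<alpha> * p \<le> 1" using assms(4) by (simp add: field_simps)
    then show ?thesis
      using True that weight_profile_in_RH[of \<epsilon> \<alpha> p] assms(1-5) by (simp add: h)
  next
    case False
    then have "\<alpha> * p > 1" using assms(4) by (simp add: field_simps)
    then show ?thesis
      using False weight_profile_not_in_RH[of \<epsilon> \<alpha> p] assms(1-5) by (simp add: h)
  qed
  have "\<not> strong_self_improving set_X linf mu"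
  proof
    assume "strong_self_improving set_X linf mu"
    \<comment> \<open>The endpoint exponent \<open>1 / \<alpha>\<close> is attained but cannot be
      exceeded, so it is the one that refutes self-improvement.\<close>
    moreover have "1 / \<alpha> > 1" using assms(4,5) by simp
    ultimately obtain \<eta> where "\<eta> > 0" "weight \<epsilon> h \<in> RH set_X linf mu (1 / \<alpha> + \<eta>)"
      using RH_iff[of "1 / \<alpha>"] unfolding strong_self_improving_def by blast
    then show False
      using RH_iff[of "1 / \<alpha> + \<eta>"] \<open>1 / \<alpha> > 1\<close> by simp
  qed
  then show ?thesis
    using Metric_space_X homogeneous_type_X Ahlfors_regular_X RH_iff by blast
qed

end
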